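(* Let $\alpha=(\alpha_1,\dots,\alpha_k)$ be a peak composition. Then $\tilde{Q}_\alpha=\tilde{S}_\alpha$, i.e. the quasisymmetric Schur $Q$-function indexed by $\alpha$ is precisely the peak Young quasisymmetric Schur function indexed by $\alpha$, if and only if either $\alpha=(2,\dots,2,\alpha_k)$ or $\alpha=(2,\dots,2,\alpha_{k-1},1)$.
   Context: In the forms $(2,\dots,2,\alpha_k)$ and $(2,\dots,2,\alpha_{k-1},1)$ the number of initial $2$'s (namely $k-1$, respectively $k-2$) may be zero. Let $n$ be a positive integer, $[n]=\{1,\dots,n\}$. A composition $\alpha=(\alpha_1,\dots,\alpha_k)$ of $n$ (written $\alpha\vDash n$) is a finite sequence of positive integers summing to $n$. It is a peak composition if all parts except possibly the last are greater than $1$. Put $\mathrm{set}(\alpha)=\{\alpha_1,\alpha_1+\alpha_2,\dots,\alpha_1+\cdots+\alpha_{k-1}\}\subseteq[n-1]$. For $X=\{x_1<\dots<x_r\}\subseteq[n-1]$, $\mathrm{comp}_n(X)=(x_1,x_2-x_1,\dots,x_r-x_{r-1},n-x_r)$. A composition $\beta$ refines $\alpha$ if $\alpha$ can be obtained by summing consecutive entries of $\beta$. For $X\subseteq[n]$, $\mathrm{Peak}(X)=\{i\in X: i-1\notin X,\ i\neq 1\}$, and $\mathrm{Peak}(\alpha)=\mathrm{Peak}(\mathrm{set}(\alpha))$. Functions: formal power series in $x_1,x_2,\dots$. $M_\alpha=\sum_{1\le i_1<\cdots<i_k}x_{i_1}^{\alpha_1}\cdots x_{i_k}^{\alpha_k}$;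 $F_\alpha=\sum_{\beta\text{ refines }\alpha}M_\beta$. For a peak composition $\alpha$ of $n$, the peak function is $K_\alpha=2^{|\mathrm{Peak}(\alpha)|+1}\sum F_\beta$, the sum over $\beta\vDash n$ with $\mathrm{Peak}(\alpha)\subseteq \mathrm{set}(\beta)\,\triangle\,(\mathrm{set}(\beta)+1)$, where $\mathrm{set}(\beta)+1=\{i+1:i\in\mathrm{set}(\beta)\}$ and $\triangle$ is symmetric difference. Diagrams: the diagram $D_\alpha$ is the left-justified array of boxes whose $i$th row from the bottom has $\alpha_i$ boxes; $(c,r)$ denotes the box in column $c$ (leftmost is 1) and row $r$ (bottom is 1). A filling $T$ of $D_\alpha$ assigns an entry $T(c,r)$ to each box. Marked peak composition tableaux: for a peak composition $\alpha$ of $n$, a marked peak composition tableau of shape $\alpha$ is a filling $T$ of $D_\alpha$ with entries from the ordered alphabet $1'<1<2'<2<\cdots$ (primed entries are called marked) such that: (1) entries in each row weakly increase left to right, with no repeated marked entries in a row; (2) entries in the first column strictly increase from bottom to top; (3) for any $k\le n$, the boxes with entries in $\{1',1,\dots,k',k\}$ form the diagram of a peak composition; (4) if an unmarked entry $i$ is in box $(2,r)$ for some row $r$, then neither $i$ nor $i'$ is in box $(1,r+1)$. The weight $\mathrm{wt}(T)$ has $i$th entry equal to the number of occurrences of $i$ or $i'$. $\mathrm{MPCT}(\alpha)$ is the set of such tableaux of shape $\alpha$ whose weight has no zero entry to the left of a nonzero entry (so $\mathrm{wt}(T)$, omitting trailing zeros, is a composition of $n$). The quasisymmetric Schur $Q$-function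 is $\tilde{Q}_\alpha=\sum_{T\in\mathrm{MPCT}(\alpha)}M_{\mathrm{wt}(T)}$. Standard peak Young composition tableaux: for a peak composition $\alpha$ of $n$, $\mathrm{SPYCT}(\alpha)$ is the set of fillings $T$ of $D_\alpha$ with entries from $[n]$, each used once, such that: (1) entries in each row increase left to right; (2) entries in the first column increase from bottom to top; (3) for all $k\le n$, the boxes with entries at most $k$ form the diagram of a peak composition; (4) if $T(c,r)<T(c+1,r')$ for some $c$ and some $r'<r$, then box $(c+1,r)$ is in $T$ and $T(c+1,r)<T(c+1,r')$. For such $T$, $\mathrm{Des}_{\leftarrow}(T)=\{i\in[n-1]: i+1\text{ is weakly left of } i\text{ in }T\}$ and $\mathrm{Peak}_{\leftarrow}(T)=\mathrm{Peak}(\mathrm{Des}_{\leftarrow}(T))$. The peak Young quasisymmetric Schur function is $\tilde{S}_\alpha=\sum_{T\in\mathrm{SPYCT}(\alpha)}K_{\mathrm{comp}_n(\mathrm{Peak}_{\leftarrow}(T))}$. *)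

theory Defs
  imports Main "HOL-Library.Poly_Mapping" "HOL-Library.FuncSet"
begin

section \<open>Compositions\<close>

definition composition :: "nat \<Rightarrow> nat list \<Rightarrow> bool" where
  "composition n \<alpha> \<longleftrightarrow> (\<forall>a\<in>set \<alpha>. 0 < a) \<and> sum_list \<alpha> = n"

definition peak_composition :: "nat \<Rightarrow> nat list \<Rightarrow> bool" where
  "peak_composition n \<alpha> \<longleftrightarrow> composition n \<alpha> \<and> (\<forall>a\<in>set (butlast \<alpha>). 1 < a)"

text \<open>\<open>comp_set \<alpha>\<close> is \<open>set(\<alpha>)\<close> and \<open>set_comp n X\<close> is \<open>comp\<^sub>n(X)\<close>.\<close>

definition comp_set :: "nat list \<Rightarrow> nat set" where
  "comp_set \<alpha> = {sum_list (take i \<alpha>) | i. 1 \<le> i \<and> i < length \<alpha>}"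

definition set_comp :: "nat \<Rightarrow> nat set \<Rightarrow> nat list" where
  "set_comp n X =
    (let xs = sorted_list_of_set X in map2 (-) (xs @ [n]) (0 # xs))"

definition refines :: "nat list \<Rightarrow> nat list \<Rightarrow> bool" where
  "refines \<beta> \<alpha> \<longleftrightarrow> (\<forall>b\<in>set \<beta>. 0 < b) \<and>
    (\<exists>bss. (\<forall>bs\<in>set bss. bs \<noteq> []) \<and> concat bss = \<beta> \<and> map sum_list bss = \<alpha>)"

definition Peak :: "nat set \<Rightarrow> nat set" where
  "Peak X = {i \<in> X. i - 1 \<notin> X \<and> i \<noteq> 1}"

section \<open>Quasisymmetric functions\<close>

text \<open>A formal power series in \<open>x\<^sub>1, x\<^sub>2, \<dots>\<close> is given by its coefficients, indexed by
  the finitely supported exponent vectors; \<open>m\<close> stands for the product of the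
  \<open>x\<^sub>i\<close> to the power \<open>Poly_Mapping.lookup m i\<close>.  The index 0 is never used.\<close>

type_synonym pseries = "(nat \<Rightarrow>\<^sub>0 nat) \<Rightarrow> int"

definition monomial :: "nat list \<Rightarrow> nat list \<Rightarrow> nat \<Rightarrow>\<^sub>0 nat" where
  "monomial is \<alpha> = (\<Sum>j<length \<alpha>. Poly_Mapping.single (is ! j) (\<alpha> ! j))"

definition M_fun :: "nat list \<Rightarrow> pseries" where
  "M_fun \<alpha> = (\<lambda>m. int (card {is. length is = length \<alpha> \<and> sorted_wrt (<) is \<and>
      (\<forall>i\<in>set is. 1 \<le> i) \<and> monomial is \<alpha> = m}))"

definition F_fun :: "nat list \<Rightarrow> pseries" where
  "F_fun \<alpha> = (\<lambda>m. \<Sum>\<beta> | refines \<beta> \<alpha>. M_fun \<beta> m)"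

definition K_fun :: "nat list \<Rightarrow> pseries" where
  "K_fun \<alpha> = (\<lambda>m. 2 ^ (card (Peak (comp_set \<alpha>)) + 1) *
     (\<Sum>\<beta> | composition (sum_list \<alpha>) \<beta> \<and>
            Peak (comp_set \<alpha>) \<subseteq> sym_diff (comp_set \<beta>) (Suc ` comp_set \<beta>).
        F_fun \<beta> m))"

section \<open>Diagrams\<close>

text \<open>Boxes are pairs (column, row), counted from 1 at the bottom left.\<close>

definition diagram :: "nat list \<Rightarrow> (nat \<times> nat) set" where
  "diagram \<alpha> = {(c, r). 1 \<le> r \<and> r \<le> length \<alpha> \<and> 1 \<le> c \<and> c \<le> \<alpha> ! (r - 1)}"

definition is_peak_diagram :: "(nat \<times> nat) set \<Rightarrow> bool" where
  "is_peak_diagram D \<longleftrightarrow> (\<exists>m \<beta>. peak_composition m \<beta> \<and> D = diagram \<beta>)"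

section \<open>Marked peak composition tableaux\<close>

datatype letter = Marked (letter_val: nat) | Unmarked (letter_val: nat)

fun letter_rank :: "letter \<Rightarrow> nat" where
  "letter_rank (Marked i) = 2 * i"
| "letter_rank (Unmarked i) = 2 * i + 1"

lemma letter_rank_inject: "letter_rank x = letter_rank y \<longleftrightarrow> x = y"
  by (cases x; cases y) (auto, presburger+)

text \<open>The order \<open>1' < 1 < 2' < 2 < \<dots>\<close>\<close>

instantiation letter :: linorder
begin

definition less_eq_letter :: "letter \<Rightarrow> letter \<Rightarrow> bool" where
  "x \<le> y \<longleftrightarrow> letter_rank x \<le> letter_rank y"

definition less_letter :: "letter \<Rightarrow> letter \<Rightarrow> bool" where
  "x < y \<longleftrightarrow> letter_rank x < letter_rank y"

instance
  by standard (auto simp: less_eq_letter_def less_letter_def letter_rank_inject[symmetric])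

end

text \<open>A filling is a function on boxes; membership in \<^term>\<open>extensional (diagram \<alpha>)\<close> fixes its
  value outside the diagram, so that distinct functions are distinct fillings.\<close>

definition marked_peak_tableau :: "nat list \<Rightarrow> (nat \<times> nat \<Rightarrow> letter) \<Rightarrow> bool" where
  "marked_peak_tableau \<alpha> T \<longleftrightarrow>
    T \<in> extensional (diagram \<alpha>) \<and>
    (\<forall>b\<in>diagram \<alpha>. 1 \<le> letter_val (T b)) \<and>
    (\<forall>c c' r. (c, r) \<in> diagram \<alpha> \<and> (c', r) \<in> diagram \<alpha> \<and> c < c' \<longrightarrow>
       T (c, r) \<le> T (c', r) \<and> (\<forall>i. \<not> (T (c, r) = Marked i \<and> T (c', r) = Marked i))) \<and>
    (\<forall>r r'. (1, r) \<in> diagram \<alpha> \<and> (1, r') \<in> diagram \<alpha> \<and> r < r' \<longrightarrow> T (1, r) < T (1, r')) \<and>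
    (\<forall>k\<le>sum_list \<alpha>. is_peak_diagram {b \<in> diagram \<alpha>. letter_val (T b) \<le> k}) \<and>
    (\<forall>i r. (2, r) \<in> diagram \<alpha> \<and> (1, r + 1) \<in> diagram \<alpha> \<and> T (2, r) = Unmarked i \<longrightarrow>
       T (1, r + 1) \<noteq> Unmarked i \<and> T (1, r + 1) \<noteq> Marked i)"

definition weight :: "nat list \<Rightarrow> (nat \<times> nat \<Rightarrow> letter) \<Rightarrow> nat \<Rightarrow> nat" where
  "weight \<alpha> T i = card {b \<in> diagram \<alpha>. T b = Unmarked i \<or> T b = Marked i}"

definition MPCT :: "nat list \<Rightarrow> (nat \<times> nat \<Rightarrow> letter) set" where
  "MPCT \<alpha> = {T. marked_peak_tableau \<alpha> T \<and>
     (\<forall>i j. 1 \<le> i \<and> i < j \<and> weight \<alpha> T j \<noteq> 0 \<longrightarrow> weight \<alpha> T i \<noteq> 0)}"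

text \<open>The weight as a composition, with the trailing zeros omitted.\<close>

definition weight_comp :: "nat list \<Rightarrow> (nat \<times> nat \<Rightarrow> letter) \<Rightarrow> nat list" where
  "weight_comp \<alpha> T = map (weight \<alpha> T) [1..<Suc (Max {i. weight \<alpha> T i \<noteq> 0})]"

definition quasisym_schur_Q :: "nat list \<Rightarrow> pseries" where
  "quasisym_schur_Q \<alpha> = (\<lambda>m. \<Sum>T\<in>MPCT \<alpha>. M_fun (weight_comp \<alpha> T) m)"

section \<open>Standard peak Young composition tableaux\<close>

definition SPYCT :: "nat list \<Rightarrow> (nat \<times> nat \<Rightarrow> nat) set" where
  "SPYCT \<alpha> = {T.
    T \<in> extensional (diagram \<alpha>) \<and>
    bij_betw T (diagram \<alpha>) {1..sum_list \<alpha>} \<and>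
    (\<forall>c c' r. (c, r) \<in> diagram \<alpha> \<and> (c', r) \<in> diagram \<alpha> \<and> c < c' \<longrightarrow> T (c, r) < T (c', r)) \<and>
    (\<forall>r r'. (1, r) \<in> diagram \<alpha> \<and> (1, r') \<in> diagram \<alpha> \<and> r < r' \<longrightarrow> T (1, r) < T (1, r')) \<and>
    (\<forall>k\<le>sum_list \<alpha>. is_peak_diagram {b \<in> diagram \<alpha>. T b \<le> k}) \<and>
    (\<forall>c r r'. (c, r) \<in> diagram \<alpha> \<and> (c + 1, r') \<in> diagram \<alpha> \<and> r' < r \<and>
       T (c, r) < T (c + 1, r') \<longrightarrow>
       (c + 1, r) \<in> diagram \<alpha> \<and> T (c + 1, r) < T (c + 1, r'))}"

definition Des_left :: "nat list \<Rightarrow> (nat \<times> nat \<Rightarrow> nat) \<Rightarrow> nat set" where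
  "Des_left \<alpha> T = {i. 1 \<le> i \<and> i < sum_list \<alpha> \<and>
     (\<exists>c r c' r'. (c, r) \<in> diagram \<alpha> \<and> (c', r') \<in> diagram \<alpha> \<and>
        T (c, r) = i \<and> T (c', r') = i + 1 \<and> c' \<le> c)}"

definition peak_young_schur :: "nat list \<Rightarrow> pseries" where
  "peak_young_schur \<alpha> =
    (\<lambda>m. \<Sum>T\<in>SPYCT \<alpha>. K_fun (set_comp (sum_list \<alpha>) (Peak (Des_left \<alpha> T))) m)"

section \<open>Finiteness of the index sets\<close>

text \<open>None of the sums and cardinalities above is over an infinite set, where it would be 0 by
  convention.\<close>

lemma finite_compositions: "finite {\<beta>. composition n \<beta>}"
proof -
  have "length \<beta> \<le> sum_list \<beta>" if "\<forall>a\<in>set \<beta>. 0 < a" for \<beta> :: "nat list"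
    using that by (induction \<beta>) auto
  then have "{\<beta>. composition n \<beta>} \<subseteq> {\<beta>. set \<beta> \<subseteq> {..n} \<and> length \<beta> \<le> n}"
    by (auto simp: composition_def intro: member_le_sum_list)
  then show ?thesis
    by (rule finite_subset) (simp add: finite_lists_length_le)
qed

lemma finite_refinements: "finite {\<beta>. refines \<beta> \<alpha>}"
proof -
  have "sum_list (concat bss) = sum_list (map sum_list bss)" for bss :: "nat list list"
    by (induction bss) auto
  then have "{\<beta>. refines \<beta> \<alpha>} \<subseteq> {\<beta>. composition (sum_list \<alpha>) \<beta>}"
    by (auto simp: refines_def composition_def)
  then show ?thesis
    using finite_compositions finite_subset by blast
qed

lemma finite_monomial_indices:
  assumes "\<forall>a\<in>set \<alpha>. 0 < a"
  shows "finite {is. length is = length \<alpha> \<and> sorted_wrt (<) is \<and>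
      (\<forall>i\<in>set is. 1 \<le> i) \<and> monomial is \<alpha> = m}" (is "finite ?A")
proof -
  have "set is \<subseteq> Poly_Mapping.keys m" if len: "length is = length \<alpha>" and m: "monomial is \<alpha> = m" for "is"
  proof
    fix i assume "i \<in> set is"
    then obtain j where j: "j < length \<alpha>" "i = is ! j"
      using len by (auto simp: in_set_conv_nth)
    have "Poly_Mapping.lookup m i = (\<Sum>j<length \<alpha>. Poly_Mapping.lookup (Poly_Mapping.single (is ! j) (\<alpha> ! j)) i)"
      by (simp add: m[symmetric] monomial_def lookup_sum)
    moreover have "\<dots> \<ge> Poly_Mapping.lookup (Poly_Mapping.single (is ! j) (\<alpha> ! j)) i"
      by (rule member_le_sum) (use j in auto)
    moreover have "Poly_Mapping.lookup (Poly_Mapping.single (is ! j) (\<alpha> ! j)) i > 0"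
      using j assms by simp
    ultimately have "Poly_Mapping.lookup m i > 0"
      by linarith
    then show "i \<in> Poly_Mapping.keys m"
      by (simp add: in_keys_iff)
  qed
  then have "?A \<subseteq> {is. set is \<subseteq> Poly_Mapping.keys m \<and> length is = length \<alpha>}"
    by blast
  then show ?thesis
    by (rule finite_subset) (simp add: finite_lists_length_eq)
qed

lemma finite_diagram: "finite (diagram \<alpha>)"
proof -
  have "diagram \<alpha> \<subseteq> {..sum_list \<alpha>} \<times> {..length \<alpha>}"
  proof
    fix b assume "b \<in> diagram \<alpha>"
    then obtain c r where b: "b = (c, r)" "1 \<le> r" "r \<le> length \<alpha>" "c \<le> \<alpha> ! (r - 1)"
      by (auto simp: diagram_def)
    then have "\<alpha> ! (r - 1) \<le> sum_list \<alpha>"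
      by (intro member_le_sum_list nth_mem) auto
    with b show "b \<in> {..sum_list \<alpha>} \<times> {..length \<alpha>}" by simp
  qed
  then show ?thesis by (rule finite_subset) simp
qed

lemma finite_SPYCT: "finite (SPYCT \<alpha>)"
proof -
  have "SPYCT \<alpha> \<subseteq> diagram \<alpha> \<rightarrow>\<^sub>E {1..sum_list \<alpha>}"
    by (auto simp: SPYCT_def PiE_def bij_betw_def)
  then show ?thesis
    by (rule finite_subset) (simp add: finite_PiE finite_diagram)
qed

lemma finite_MPCT: "finite (MPCT \<alpha>)"
proof -
  let ?n = "card (diagram \<alpha>)"
  have bound: "letter_val (T b) \<le> ?n" if T: "T \<in> MPCT \<alpha>" and b: "b \<in> diagram \<alpha>" for T b
  proof -
    have nz: "weight \<alpha> T i \<noteq> 0 \<longleftrightarrow> i \<in> (letter_val \<circ> T) ` diagram \<alpha>" for i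
    proof -
      have "{b \<in> diagram \<alpha>. T b = Unmarked i \<or> T b = Marked i}
          = {b \<in> diagram \<alpha>. letter_val (T b) = i}"
        by (metis letter.exhaust letter.sel)
      then show ?thesis
        using finite_diagram[of \<alpha>] by (auto simp: weight_def)
    qed
    have "{1..letter_val (T b)} \<subseteq> (letter_val \<circ> T) ` diagram \<alpha>"
    proof
      fix i assume i: "i \<in> {1..letter_val (T b)}"
      have "weight \<alpha> T (letter_val (T b)) \<noteq> 0"
        using nz b by auto
      then have "weight \<alpha> T i \<noteq> 0"
        using T i unfolding MPCT_def
        by (cases "i = letter_val (T b)") (simp, use le_neq_implies_less in \<open>simp, blast\<close>)
      then show "i \<in> (letter_val \<circ> T) ` diagram \<alpha>"
        using nz by blast
    qed
    then have "card {1..letter_val (T b)} \<le> card ((letter_val \<circ> T) ` diagram \<alpha>)"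
      by (intro card_mono) (auto simp: finite_diagram)
    also have "\<dots> \<le> ?n"
      by (intro card_image_le finite_diagram)
    finally show ?thesis by simp
  qed
  have "MPCT \<alpha> \<subseteq> diagram \<alpha> \<rightarrow>\<^sub>E (Marked ` {..?n} \<union> Unmarked ` {..?n})"
  proof
    fix T assume T: "T \<in> MPCT \<alpha>"
    have "T b \<in> Marked ` {..?n} \<union> Unmarked ` {..?n}" if "b \<in> diagram \<alpha>" for b
      using bound[OF T that] by (cases "T b") auto
    then show "T \<in> diagram \<alpha> \<rightarrow>\<^sub>E (Marked ` {..?n} \<union> Unmarked ` {..?n})"
      using T by (auto simp: MPCT_def marked_peak_tableau_def PiE_def)
  qed
  then show ?thesis
    by (rule finite_subset) (simp add: finite_PiE finite_diagram)
qed

end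

theory Submission
  imports Defs "HOL-Library.Product_Lexorder"
begin

text \<open>Both sides are expanded in the monomial basis.  For a standard tableau \<open>T\<close> call a marked
  filling compatible with \<open>T\<close> if, along consecutive entries of \<open>T\<close>, its letters weakly increase,
  equal marked letters move weakly left and equal unmarked letters move strictly right.  The
  compatible fillings of weight \<open>\<gamma>\<close> number \<open>2 ^ length \<gamma>\<close> if every peak of \<open>T\<close> lies in
  \<open>set(\<gamma>) \<union> (set(\<gamma>) + 1)\<close> and 0 otherwise, which is the coefficient of \<open>M\<^sub>\<gamma>\<close> in the peak function
  of \<open>T\<close>.  Every filling compatible with a tableau satisfying conditions (1)--(3) of SPYCT is a
  marked peak composition tableau.

  For the listed shapes condition (4) of SPYCT is vacuous and every marked tableau is compatible
  with exactly one standard tableau, its standardization.  For all other shapes some tableau satisfies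
  (1)--(3) but not (4); then the coefficient of \<open>x\<^sub>1 \<cdots> x\<^sub>n\<close> is strictly larger in the quasisymmetric
  Schur Q-function.\<close>

section \<open>Compositions and peak functions\<close>

text \<open>The count of compatible fillings holds for every tableau satisfying (1)--(3), so
  condition (4) enters only through the tableaux over which the sum runs; what remains is whether
  the sets of compatible fillings partition the marked tableaux. In general they do not: in shape
  \<open>(3,3)\<close> two equal marked letters in column 3 can leave two standard tableaux
  possible, and two equal unmarked letters there leave none. For the listed shapes no two boxes
  beyond column 2 share a column, and in columns 1 and 2 condition (3) orders the boxes by row.
  Condition (4) is void at \<open>c = 1\<close> for every shape, since (3) forces
  \<open>T (2, r') < T (1, r)\<close> for \<open>r' < r\<close>; only longer rows can make it bite.
  The coefficient of \<open>x_1 ... x_n\<close> avoids standardization altogether: with pairwise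
  different values a filling is its tableau up to marks, so distinct tableaux have disjoint sets of
  compatible fillings.\<close>

lemma composition_Nil [simp]: "composition n [] \<longleftrightarrow> n = 0"
  by (auto simp: composition_def)

lemma composition_Cons [simp]: "composition n (a # as) \<longleftrightarrow> 0 < a \<and> a \<le> n \<and> composition (n - a) as"
  by (auto simp: composition_def)

lemma comp_set_Nil [simp]: "comp_set [] = {}"
  by (auto simp: comp_set_def)

lemma comp_set_append:
  assumes "as \<noteq> []" "bs \<noteq> []"
  shows "comp_set (as @ bs) = comp_set as \<union> {sum_list as} \<union> (+) (sum_list as) ` comp_set bs"
proof (intro subset_antisym subsetI)
  fix x assume "x \<in> comp_set (as @ bs)"
  then obtain i where i: "x = sum_list (take i (as @ bs))" "1 \<le> i" "i < length as + length bs"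
    by (auto simp: comp_set_def)
  consider "i < length as" | "i = length as" | "length as < i" by linarith
  then show "x \<in> comp_set as \<union> {sum_list as} \<union> (+) (sum_list as) ` comp_set bs"
  proof cases
    case 1
    with i show ?thesis by (auto simp: comp_set_def)
  next
    case 2
    with i show ?thesis by simp
  next
    case 3
    with i have "sum_list (take (i - length as) bs) \<in> comp_set bs"
      by (auto simp: comp_set_def)
    with 3 i show ?thesis by simp
  qed
next
  fix x assume "x \<in> comp_set as \<union> {sum_list as} \<union> (+) (sum_list as) ` comp_set bs"
  then consider i where "x = sum_list (take i as)" "1 \<le> i" "i < length as" | "x = sum_list as"
    | i where "x = sum_list as + sum_list (take i bs)" "1 \<le> i" "i < length bs"
    by (auto simp: comp_set_def)
  then show "x \<in> comp_set (as @ bs)"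
  proof cases
    case 1
    then show ?thesis by (auto simp: comp_set_def intro!: exI[of _ i])
  next
    case 2
    with assms show ?thesis
      by (auto simp: comp_set_def Suc_le_eq intro!: exI[of _ "length as"])
  next
    case 3
    then show ?thesis by (auto simp: comp_set_def intro!: exI[of _ "length as + i"])
  qed
qed

lemma comp_set_singleton [simp]: "comp_set [a] = {}"
  by (auto simp: comp_set_def)

lemma comp_set_Cons: "as \<noteq> [] \<Longrightarrow> comp_set (a # as) = insert a ((+) a ` comp_set as)"
  using comp_set_append[of "[a]" as] by simp

lemma comp_set_subset: "composition n \<gamma> \<Longrightarrow> comp_set \<gamma> \<subseteq> {1..<n}"
proof (induction \<gamma> arbitrary: n)
  case (Cons a as)
  show ?case
  proof (cases "as = []")
    case False
    then have "0 < n - a" using Cons.prems by (cases as) auto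
    moreover have "comp_set as \<subseteq> {1..<n - a}" using Cons by simp
    ultimately show ?thesis using Cons.prems False by (fastforce simp: comp_set_Cons)
  qed simp
qed simp

lemma finite_comp_set: "composition n \<gamma> \<Longrightarrow> finite (comp_set \<gamma>)"
  using comp_set_subset finite_subset by blast

lemma card_comp_set: "composition n \<gamma> \<Longrightarrow> \<gamma> \<noteq> [] \<Longrightarrow> Suc (card (comp_set \<gamma>)) = length \<gamma>"
proof (induction \<gamma> arbitrary: n)
  case (Cons a as)
  show ?case
  proof (cases "as = []")
    case False
    have c: "composition (n - a) as" using Cons.prems by simp
    then have "comp_set as \<subseteq> {1..<n - a}" "finite (comp_set as)"
      by (rule comp_set_subset finite_comp_set)+
    then have "card (insert a ((+) a ` comp_set as)) = Suc (card (comp_set as))"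
      by (subst card_insert_disjoint) (auto simp: card_image)
    then show ?thesis using Cons.IH[OF c False] False by (simp add: comp_set_Cons)
  qed simp
qed simp

lemma comp_set_eq_empty: "comp_set \<gamma> = {} \<Longrightarrow> length \<gamma> \<le> 1"
  by (cases \<gamma>; cases "tl \<gamma>") (auto simp: comp_set_Cons)

text \<open>Makes \<open>comp_set\<close> invertible part by part, which is the induction step of
  \<open>inj_on_comp_set\<close>.\<close>

lemma Min_comp_set:
  assumes "composition n (a # as)" "as \<noteq> []"
  shows "Min (comp_set (a # as)) = a" "comp_set as = (\<lambda>x. x - a) ` (comp_set (a # as) - {a})"
proof -
  have "composition (n - a) as" using assms by simp
  then have c: "comp_set as \<subseteq> {1..<n - a}" "finite (comp_set as)"
    by (rule comp_set_subset finite_comp_set)+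
  show "Min (comp_set (a # as)) = a"
    using c assms by (auto simp: comp_set_Cons intro!: Min_eqI)
  have "(+) a ` comp_set as - {a} = (+) a ` comp_set as" using c by auto
  then show "comp_set as = (\<lambda>x. x - a) ` (comp_set (a # as) - {a})"
    using assms by (simp add: comp_set_Cons image_image)
qed

lemma inj_on_comp_set: "inj_on comp_set {\<gamma>. composition n \<gamma>}"
proof -
  have "\<gamma> = \<delta>" if "composition n \<gamma>" "composition n \<delta>" "comp_set \<gamma> = comp_set \<delta>" for \<gamma> \<delta>
    using that
  proof (induction \<gamma> arbitrary: n \<delta>)
    case Nil
    then show ?case by (cases \<delta>) auto
  next
    case (Cons a as)
    then obtain b bs where \<delta>: "\<delta> = b # bs" by (cases \<delta>) auto
    show ?case
    proof (cases "as = [] \<or> bs = []")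
      case True
      then have "as = []" "bs = []"
        using comp_set_eq_empty[of "a # as"] comp_set_eq_empty[of \<delta>] Cons.prems \<delta> by auto
      then show ?thesis using Cons.prems \<delta> by auto
    next
      case False
      have "a = b"
        using Min_comp_set(1)[OF Cons.prems(1)] Min_comp_set(1)[of n b bs] Cons.prems \<delta> False
        by auto
      moreover have "comp_set as = comp_set bs"
        using Min_comp_set(2)[OF Cons.prems(1)] Min_comp_set(2)[of n b bs] Cons.prems \<delta> False
          \<open>a = b\<close> by auto
      ultimately show ?thesis using Cons \<delta> by auto
    qed
  qed
  then show ?thesis by (auto simp: inj_on_def)
qed

text \<open>The starting point \<open>a\<close> is arbitrary so that the induction on
  \<open>xs\<close> can move it; \<open>set_comp\<close> is the case \<open>a = 0\<close>.\<close>

lemma differences_composition: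
  assumes "sorted_wrt (<) (a # xs @ [n])"
  shows "composition (n - a) (map2 (-) (xs @ [n]) (a # xs))"
    and "comp_set (map2 (-) (xs @ [n]) (a # xs)) = (\<lambda>x. x - a) ` set xs"
  using assms
proof (induction xs arbitrary: a)
  case (Cons x xs)
  {
    case 1
    then show ?case using Cons.IH(1)[of x] by (auto simp: composition_def)
  next
    case 2
    have "(+) (x - a) ` (\<lambda>y. y - x) ` set xs = (\<lambda>y. y - a) ` set xs"
      using 2 by (force simp: image_iff)
    moreover have "map2 (-) (xs @ [n]) (x # xs) \<noteq> []" by (cases xs) auto
    ultimately show ?case
      using 2 Cons.IH(2)[of x] by (simp add: comp_set_Cons)
  }
qed (auto simp: composition_def)

lemma set_comp:
  assumes "X \<subseteq> {1..<n}" "0 < n"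
  shows "composition n (set_comp n X)" "comp_set (set_comp n X) = X"
proof -
  have fin: "finite X" using assms finite_subset by blast
  have "sorted_wrt (<) (0 # sorted_list_of_set X @ [n])"
    using assms fin by (auto simp: sorted_wrt_append)
  from differences_composition[OF this] show "composition n (set_comp n X)" "comp_set (set_comp n X) = X"
    using fin unfolding set_comp_def Let_def by auto
qed

lemma bij_betw_comp_set:
  assumes "0 < n"
  shows "bij_betw comp_set {\<gamma>. composition n \<gamma>} (Pow {1..<n})"
proof -
  have "X \<in> comp_set ` {\<gamma>. composition n \<gamma>}" if "X \<subseteq> {1..<n}" for X
    using set_comp[OF that assms] by (metis imageI mem_Collect_eq)
  then show ?thesis
    using comp_set_subset inj_on_comp_set by (fastforce simp: bij_betw_def)
qed

section \<open>Refinement as inclusion of partial-sum sets\<close>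

lemma sum_list_concat: "sum_list (concat bss) = sum_list (map sum_list bss)"
  for bss :: "nat list list"
  by (induction bss) auto

lemma composition_append:
  "composition n (as @ bs) \<longleftrightarrow> sum_list as \<le> n \<and> composition (sum_list as) as \<and> composition (n - sum_list as) bs"
  by (auto simp: composition_def)

lemma concat_eq_Nil_iff: "\<forall>bs\<in>set bss. bs \<noteq> [] \<Longrightarrow> concat bss = [] \<longleftrightarrow> bss = []"
  by (cases bss) auto

lemma comp_set_concat:
  "\<forall>bs\<in>set bss. bs \<noteq> [] \<Longrightarrow> comp_set (map sum_list bss) \<subseteq> comp_set (concat bss)"
proof (induction bss)
  case (Cons bs bss)
  show ?case
  proof (cases "bss = []")
    case False
    then have "concat bss \<noteq> []" using Cons.prems concat_eq_Nil_iff[of bss] by auto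
    then show ?thesis
      using Cons False by (auto simp: comp_set_append comp_set_Cons)
  qed simp
qed simp

text \<open>The first part of \<open>\<beta>\<close> is a partial sum of \<open>\<gamma>\<close>, so
  \<open>\<gamma>\<close> splits there. The left piece becomes the first group, and the right piece
  is handled by induction.\<close>

lemma comp_set_subset_refines:
  assumes "composition n \<beta>" "composition n \<gamma>" "comp_set \<beta> \<subseteq> comp_set \<gamma>"
  shows "refines \<gamma> \<beta>"
  using assms
proof (induction \<beta> arbitrary: n \<gamma>)
  case Nil
  then have "\<gamma> = []" by (cases \<gamma>) auto
  then show ?case by (auto simp: refines_def intro: exI[of _ "[]"])
next
  case (Cons b bs)
  show ?case
  proof (cases "bs = []")
    case True
    have "\<gamma> \<noteq> []" using Cons.prems by auto
    then show ?thesis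
      using True Cons.prems by (auto simp: refines_def composition_def intro!: exI[of _ "[\<gamma>]"])
  next
    case False
    then have "b \<in> comp_set \<gamma>" using Cons.prems by (auto simp: comp_set_Cons)
    then obtain i where i: "b = sum_list (take i \<gamma>)" "1 \<le> i" "i < length \<gamma>"
      by (auto simp: comp_set_def)
    define \<gamma>1 \<gamma>2 where \<gamma>12: "\<gamma>1 = take i \<gamma>" "\<gamma>2 = drop i \<gamma>"
    then have \<gamma>: "\<gamma> = \<gamma>1 @ \<gamma>2" "\<gamma>1 \<noteq> []" "\<gamma>2 \<noteq> []" "b = sum_list \<gamma>1"
      using i by auto
    then have c: "composition b \<gamma>1" "composition (n - b) \<gamma>2"
      using Cons.prems by (auto simp: composition_append)
    have cb: "composition (n - b) bs" using Cons.prems by auto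
    have "comp_set bs \<subseteq> comp_set \<gamma>2"
    proof
      fix x assume x: "x \<in> comp_set bs"
      then have "b + x \<in> comp_set \<gamma>" using False Cons.prems by (auto simp: comp_set_Cons)
      moreover have "0 < x" using x comp_set_subset[OF cb] by auto
      moreover have "comp_set \<gamma>1 \<subseteq> {1..<b}" using c comp_set_subset by blast
      ultimately show "x \<in> comp_set \<gamma>2"
        using \<gamma> by (auto simp: comp_set_append)
    qed
    from Cons.IH[OF cb c(2) this] obtain bss where
      "\<forall>bs\<in>set bss. bs \<noteq> []" "concat bss = \<gamma>2" "map sum_list bss = bs"
      by (auto simp: refines_def)
    then show ?thesis
      using \<gamma> Cons.prems by (auto simp: refines_def composition_def intro!: exI[of _ "\<gamma>1 # bss"])
  qed
qed

text \<open>Turns the sums over refinements in \<open>F_fun\<close> into counts of subsets of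
  \<open>comp_set \<gamma>\<close>.\<close>

lemma refines_iff:
  assumes "composition n \<beta>"
  shows "refines \<gamma> \<beta> \<longleftrightarrow> composition n \<gamma> \<and> comp_set \<beta> \<subseteq> comp_set \<gamma>"
  using assms comp_set_subset_refines[of n \<beta> \<gamma>] comp_set_concat
  by (auto simp: refines_def composition_def sum_list_concat)

text \<open>Each \<open>p \<in> P\<close> halves the number of choices: if \<open>p \<in> G\<close>, membership of \<open>p\<close> in \<open>B\<close> is
  determined by that of \<open>p - 1\<close>; if \<open>p \<notin> G\<close>, then \<open>p - 1\<close> is forced into \<open>B\<close>.\<close>

lemma card_xor_subsets:
  assumes fin: "finite G" and P: "\<And>p. p \<in> P \<Longrightarrow> 2 \<le> p \<and> p - 1 \<notin> P"
    and PG: "P \<subseteq> G \<union> Suc ` G"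
  shows "card {B. B \<subseteq> G \<and> P \<subseteq> sym_diff B (Suc ` B)} * 2 ^ card P = 2 ^ card G"
proof -
  have finP: "finite P" using PG fin finite_subset by blast
  have xor: "P \<subseteq> sym_diff B (Suc ` B) \<longleftrightarrow> (\<forall>p\<in>P. (p \<in> B) \<noteq> (p - 1 \<in> B))" for B
  proof -
    have "p \<in> Suc ` B \<longleftrightarrow> p - 1 \<in> B" if "p \<in> P" for p
    proof -
      have "p = Suc (p - 1)" using P[OF that] by simp
      then show ?thesis by (metis image_iff nat.inject)
    qed
    then show ?thesis by blast
  qed
  define R where "R = (\<lambda>p. p - 1) ` (P - G)"
  have pred: "p - 1 \<in> G" "p - 1 \<notin> P" if "p \<in> P - G" for p
    using that PG P[of p] by auto
  have inj: "inj_on (\<lambda>p. p - 1) (P - G)"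
  proof (rule inj_onI)
    fix x y assume "x \<in> P - G" "y \<in> P - G" "x - 1 = y - 1"
    then show "x = y" using P[of x] P[of y] by auto
  qed
  have R: "R \<subseteq> G" "R \<inter> P = {}" using pred by (auto simp: R_def)
  have R_pred: "p - 1 \<notin> R" if "p \<in> P \<inter> G" for p
  proof
    assume "p - 1 \<in> R"
    then obtain q where q: "q \<in> P - G" "p - 1 = q - 1" by (auto simp: R_def)
    then have "p = q" using that P[of p] P[of q] by auto
    with that q show False by blast
  qed
  \<comment> \<open>The positions at which membership in \<open>B\<close> is a free choice: neither
    decided by a predecessor (\<open>P \<inter> G\<close>) nor forced (\<open>R\<close>).\<close>
  define Fr where "Fr = G - (P \<inter> G) - R"
  have "card Fr + card P = card G"
  proof -
    have "card P = card (P \<inter> G) + card (P - G)"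
      using finP by (metis card_Int_Diff)
    also have "card (P - G) = card R" using inj by (simp add: R_def card_image)
    also have "card (P \<inter> G) + card R = card ((P \<inter> G) \<union> R)"
      by (rule card_Un_disjoint[symmetric]) (use R fin finP finite_subset in \<open>auto\<close>)
    finally have "card P = card ((P \<inter> G) \<union> R)" .
    moreover have "card Fr = card G - card ((P \<inter> G) \<union> R)"
    proof -
      have "Fr = G - ((P \<inter> G) \<union> R)" by (auto simp: Fr_def)
      moreover have "finite (P \<inter> G \<union> R)" "P \<inter> G \<union> R \<subseteq> G"
        using R fin finite_subset by auto
      ultimately show ?thesis by (simp add: card_Diff_subset)
    qed
    moreover have "card ((P \<inter> G) \<union> R) \<le> card G"
      by (rule card_mono) (use R fin in auto)
    ultimately show ?thesis by simp
  qed
  moreover have "bij_betw (\<lambda>B. B \<inter> Fr) {B. B \<subseteq> G \<and> P \<subseteq> sym_diff B (Suc ` B)} (Pow Fr)"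
  \<comment> \<open>The inverse adds the forced elements and then decides each
    \<open>p \<in> P \<inter> G\<close> by its predecessor. Testing \<open>p - 1\<close> against
    \<open>F\<close> alone suffices: \<open>p - 1\<close> is not in \<open>P\<close>, and by
    \<open>R_pred\<close> not in \<open>R\<close>.\<close>
  proof (rule bij_betw_byWitness[where f' = "\<lambda>F. F \<union> R \<union> {p \<in> P \<inter> G. p - 1 \<notin> F}"])
    show "\<forall>B\<in>{B. B \<subseteq> G \<and> P \<subseteq> sym_diff B (Suc ` B)}.
        B \<inter> Fr \<union> R \<union> {p \<in> P \<inter> G. p - 1 \<notin> B \<inter> Fr} = B"
    proof
      fix B assume "B \<in> {B. B \<subseteq> G \<and> P \<subseteq> sym_diff B (Suc ` B)}"
      then have B: "B \<subseteq> G" "\<And>p. p \<in> P \<Longrightarrow> (p \<in> B) \<noteq> (p - 1 \<in> B)" by (auto simp: xor)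
      have "R \<subseteq> B" using B by (auto simp: R_def)
      moreover have "p \<in> B \<longleftrightarrow> p - 1 \<notin> B \<inter> Fr" if "p \<in> P \<inter> G" for p
        using that B R_pred[OF that] P[of p] by (auto simp: Fr_def)
      ultimately show "B \<inter> Fr \<union> R \<union> {p \<in> P \<inter> G. p - 1 \<notin> B \<inter> Fr} = B"
        using B(1) by (auto simp: Fr_def)
    qed
    show "\<forall>F\<in>Pow Fr. (F \<union> R \<union> {p \<in> P \<inter> G. p - 1 \<notin> F}) \<inter> Fr = F"
      by (auto simp: Fr_def)
    show "(\<lambda>B. B \<inter> Fr) ` {B. B \<subseteq> G \<and> P \<subseteq> sym_diff B (Suc ` B)} \<subseteq> Pow Fr" by auto
    show "(\<lambda>F. F \<union> R \<union> {p \<in> P \<inter> G. p - 1 \<notin> F}) ` Pow Fr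
        \<subseteq> {B. B \<subseteq> G \<and> P \<subseteq> sym_diff B (Suc ` B)}"
    proof
      fix B assume "B \<in> (\<lambda>F. F \<union> R \<union> {p \<in> P \<inter> G. p - 1 \<notin> F}) ` Pow Fr"
      then obtain F where F: "F \<subseteq> Fr" and B: "B = F \<union> R \<union> {p \<in> P \<inter> G. p - 1 \<notin> F}"
        by auto
      have "(p \<in> B) \<noteq> (p - 1 \<in> B)" if p: "p \<in> P" for p
      proof (cases "p \<in> G")
        case True
        then have "p \<in> B \<longleftrightarrow> p - 1 \<notin> F" using p F R by (auto simp: B Fr_def)
        moreover have "p - 1 \<in> B \<longleftrightarrow> p - 1 \<in> F"
          using True p R_pred[of p] P[of p] by (auto simp: B)
        ultimately show ?thesis by simp
      next
        case False
        then have "p - 1 \<in> R" "p \<notin> B" using p F R by (auto simp: B Fr_def R_def)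
        then show ?thesis by (simp add: B)
      qed
      moreover have "B \<subseteq> G" using F R by (auto simp: B Fr_def)
      ultimately show "B \<in> {B. B \<subseteq> G \<and> P \<subseteq> sym_diff B (Suc ` B)}" by (auto simp: xor)
    qed
  qed
  then have "card {B. B \<subseteq> G \<and> P \<subseteq> sym_diff B (Suc ` B)} = 2 ^ card Fr"
    using fin by (simp add: bij_betw_same_card card_Pow Fr_def)
  ultimately show ?thesis by (metis power_add)
qed

text \<open>The set \<open>P\<close> has no two consecutive elements, so it is its own peak set. The
  coefficient of \<open>M_fun \<gamma>\<close> counts the subsets \<open>B\<close> of
  \<open>comp_set \<gamma>\<close> with the symmetric difference property,
  \<open>2 ^ (card (comp_set \<gamma>) - card P)\<close> many or none; the factor
  \<open>2 ^ (card P + 1)\<close> turns this into \<open>2 ^ length \<gamma>\<close>.\<close>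

lemma K_fun_set_comp:
  assumes n: "0 < n" and P: "P \<subseteq> {1..<n}" "\<And>p. p \<in> P \<Longrightarrow> 2 \<le> p \<and> p - 1 \<notin> P"
  shows "K_fun (set_comp n P) m = (\<Sum>\<gamma> | composition n \<gamma>.
    (if P \<subseteq> comp_set \<gamma> \<union> Suc ` comp_set \<gamma> then 2 ^ length \<gamma> else 0) * M_fun \<gamma> m)"
proof -
  let ?X = "\<lambda>B. P \<subseteq> sym_diff B (Suc ` B)"
  let ?N = "\<lambda>\<gamma>. card {\<beta>. composition n \<beta> \<and> ?X (comp_set \<beta>) \<and> comp_set \<beta> \<subseteq> comp_set \<gamma>}"
  have "Peak P = P" using P(2) by (force simp: Peak_def)
  then have "K_fun (set_comp n P) m = 2 ^ (card P + 1) *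
      (\<Sum>\<beta> | composition n \<beta> \<and> ?X (comp_set \<beta>). F_fun \<beta> m)"
    using set_comp[OF P(1) n] by (simp add: K_fun_def composition_def)
  also have "(\<Sum>\<beta> | composition n \<beta> \<and> ?X (comp_set \<beta>). F_fun \<beta> m) =
      (\<Sum>\<beta> | composition n \<beta> \<and> ?X (comp_set \<beta>).
        \<Sum>\<gamma> | composition n \<gamma>. if comp_set \<beta> \<subseteq> comp_set \<gamma> then M_fun \<gamma> m else 0)"
  proof (rule sum.cong)
    fix \<beta> assume "\<beta> \<in> {\<beta>. composition n \<beta> \<and> ?X (comp_set \<beta>)}"
    then have "{\<gamma>. refines \<gamma> \<beta>} = {\<gamma>. composition n \<gamma> \<and> comp_set \<beta> \<subseteq> comp_set \<gamma>}"
      using refines_iff by auto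
    then show "F_fun \<beta> m = (\<Sum>\<gamma> | composition n \<gamma>.
        if comp_set \<beta> \<subseteq> comp_set \<gamma> then M_fun \<gamma> m else 0)"
      by (simp add: F_fun_def sum.inter_filter[symmetric] finite_compositions)
  qed simp
  also have "\<dots> = (\<Sum>\<gamma> | composition n \<gamma>. \<Sum>\<beta> | composition n \<beta> \<and> ?X (comp_set \<beta>).
      if comp_set \<beta> \<subseteq> comp_set \<gamma> then M_fun \<gamma> m else 0)"
    by (rule sum.swap)
  also have "\<dots> = (\<Sum>\<gamma> | composition n \<gamma>. int (?N \<gamma>) * M_fun \<gamma> m)"
    by (simp add: sum.inter_filter[symmetric] finite_compositions conj_assoc)
  also have "2 ^ (card P + 1) * \<dots> = (\<Sum>\<gamma> | composition n \<gamma>.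
    (if P \<subseteq> comp_set \<gamma> \<union> Suc ` comp_set \<gamma> then 2 ^ length \<gamma> else 0) * M_fun \<gamma> m)"
    unfolding sum_distrib_left
  proof (rule sum.cong)
    fix \<gamma> assume "\<gamma> \<in> {\<gamma>. composition n \<gamma>}"
    then have \<gamma>: "composition n \<gamma>" by simp
    then have sub: "comp_set \<gamma> \<subseteq> {1..<n}" and fin: "finite (comp_set \<gamma>)"
      by (rule comp_set_subset finite_comp_set)+
    have "\<gamma> \<noteq> []" using \<gamma> n by auto
    then have len: "length \<gamma> = Suc (card (comp_set \<gamma>))" using card_comp_set[OF \<gamma>] by simp
    have "bij_betw comp_set {\<beta>. composition n \<beta> \<and> ?X (comp_set \<beta>) \<and> comp_set \<beta> \<subseteq> comp_set \<gamma>}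
        {B. B \<subseteq> comp_set \<gamma> \<and> ?X B}"
    proof (rule bij_betw_subset[OF bij_betw_comp_set[OF n], rotated])
      show "comp_set ` {\<beta>. composition n \<beta> \<and> ?X (comp_set \<beta>) \<and> comp_set \<beta> \<subseteq> comp_set \<gamma>} =
          {B. B \<subseteq> comp_set \<gamma> \<and> ?X B}"
      proof (intro subset_antisym subsetI)
        fix B assume B: "B \<in> {B. B \<subseteq> comp_set \<gamma> \<and> ?X B}"
        then have "B \<subseteq> {1..<n}" using sub by auto
        from set_comp[OF this n] B
        show "B \<in> comp_set ` {\<beta>. composition n \<beta> \<and> ?X (comp_set \<beta>) \<and> comp_set \<beta> \<subseteq> comp_set \<gamma>}"
          by (intro image_eqI[of _ _ "set_comp n B"]) auto
      qed auto
    qed auto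
    then have N: "?N \<gamma> = card {B. B \<subseteq> comp_set \<gamma> \<and> ?X B}" by (rule bij_betw_same_card)
    show "2 ^ (card P + 1) * (int (?N \<gamma>) * M_fun \<gamma> m) =
        (if P \<subseteq> comp_set \<gamma> \<union> Suc ` comp_set \<gamma> then 2 ^ length \<gamma> else 0) * M_fun \<gamma> m"
    proof (cases "P \<subseteq> comp_set \<gamma> \<union> Suc ` comp_set \<gamma>")
      case True
      have "?N \<gamma> * 2 ^ card P = 2 ^ card (comp_set \<gamma>)"
        unfolding N by (rule card_xor_subsets) (use fin P True in auto)
      from arg_cong[OF this, of int] have "int (?N \<gamma>) * 2 ^ card P = 2 ^ card (comp_set \<gamma>)"
        by (simp only: of_nat_mult of_nat_power of_nat_numeral)
      then have "2 ^ (card P + 1) * int (?N \<gamma>) = 2 ^ length \<gamma>"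
        using len by (simp add: mult.commute)
      then show ?thesis using True by (simp only: mult.assoc[symmetric] if_True)
    next
      case False
      then have "{B. B \<subseteq> comp_set \<gamma> \<and> ?X B} = {}" by blast
      then show ?thesis using False unfolding N by (simp only: card.empty) simp
    qed
  qed simp
  finally show ?thesis .
qed

text \<open>A letter is fixed at position \<open>i\<close> (for \<open>i \<in> D\<close>) or \<open>i + 1\<close> (for \<open>i \<notin> D\<close>) for each of the
  \<open>n - 1 - card G\<close> non-cuts \<open>i\<close>; two of these demands clash exactly at a peak of \<open>D\<close> interior
  to a block of \<open>G\<close>.\<close>

lemma card_mark_sets:
  assumes n: "0 < n" and G: "G \<subseteq> {1..<n}" and D: "D \<subseteq> {1..<n}"
  shows "card {S. S \<subseteq> {1..n} \<and> (\<forall>i\<in>{1..<n} - G. if i \<in> D then i \<in> S else Suc i \<notin> S)} =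
    (if Peak D \<subseteq> G \<union> Suc ` G then 2 ^ Suc (card G) else 0)"
proof -
  \<comment> \<open>The positions forced into \<open>S\<close> and those forced out of it; the
    admissible \<open>S\<close> form an interval of sets between \<open>I\<close> and the complement
    of \<open>Z\<close>.\<close>
  define I Z where "I = D - G" and "Z = Suc ` ({1..<n} - G - D)"
  let ?\<S> = "{S. S \<subseteq> {1..n} \<and> (\<forall>i\<in>{1..<n} - G. if i \<in> D then i \<in> S else Suc i \<notin> S)}"
  have \<S>: "?\<S> = {S. I \<subseteq> S \<and> S \<subseteq> {1..n} - Z}"
    using D by (auto simp: I_def Z_def)
  have fin: "finite G" "finite D" using G D finite_subset by auto
  have IZ: "I \<subseteq> {1..n}" "Z \<subseteq> {1..n}" using D by (auto simp: I_def Z_def)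
  have mem_Z: "i \<in> Z \<longleftrightarrow> 2 \<le> i \<and> i \<le> n \<and> i - 1 \<notin> G \<and> i - 1 \<notin> D" for i
    by (cases i) (auto simp: Z_def image_iff)
  have mem_Suc: "i \<in> Suc ` G \<longleftrightarrow> 2 \<le> i \<and> i - 1 \<in> G" for i
    using G by (cases i) (auto simp: image_iff)
  have disj: "I \<inter> Z = {} \<longleftrightarrow> Peak D \<subseteq> G \<union> Suc ` G"
  proof -
    have dn: "1 \<le> i \<and> i < n" if "i \<in> D" for i using D that by auto
    have "i \<in> I \<inter> Z \<longleftrightarrow> i \<in> Peak D - (G \<union> Suc ` G)" for i
      using dn[of i] by (cases "i \<in> D") (auto simp: I_def mem_Z mem_Suc Peak_def)
    then show ?thesis by blast
  qed
  show ?thesis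
  proof (cases "I \<inter> Z = {}")
    case True
    have "bij_betw (\<lambda>S. S - I) ?\<S> (Pow ({1..n} - Z - I))"
      unfolding \<S> using True IZ
      by (intro bij_betw_byWitness[where f' = "\<lambda>S. S \<union> I"]) auto
    then have "card ?\<S> = 2 ^ card ({1..n} - Z - I)"
      by (simp add: bij_betw_same_card card_Pow)
    moreover have "card ({1..n} - Z - I) = Suc (card G)"
    proof -
      have "card Z = card ({1..<n} - G - D)" by (simp add: Z_def card_image)
      moreover have "({1..<n} - G - D) \<union> I = {1..<n} - G" using D by (auto simp: I_def)
      then have "card ({1..<n} - G - D) + card I = card ({1..<n} - G)"
        using fin by (subst card_Un_disjoint[symmetric]) (auto simp: I_def)
      moreover have "card ({1..<n} - G) = n - 1 - card G"
        using G fin by (simp add: card_Diff_subset)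
      moreover have "card G \<le> n - 1"
        using card_mono[OF _ G] by simp
      moreover have ZI: "{1..n} - Z - I = {1..n} - (Z \<union> I)" by blast
      moreover have "finite I" "finite Z" using IZ finite_subset by auto
      then have "card ({1..n} - Z - I) = n - (card Z + card I)"
        unfolding ZI using IZ True by (simp add: card_Diff_subset card_Un_disjoint Int_commute)
      ultimately show ?thesis using n by linarith
    qed
    ultimately show ?thesis using True disj by simp
  next
    case False
    then have "?\<S> = {}" unfolding \<S> by blast
    then show ?thesis using False disj by (simp only: card.empty if_False)
  qed
qed

section \<open>Peak diagrams and compatible fillings\<close>

lemma initial_segment:
  fixes A :: "nat set"
  assumes "finite A" "\<And>x. x \<in> A \<Longrightarrow> 1 \<le> x" "\<And>x. 1 \<le> x \<Longrightarrow> Suc x \<in> A \<Longrightarrow> x \<in> A"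
  shows "A = {1..card A}"
proof (cases "A = {}")
  case False
  have down: "x \<in> A" if "y \<in> A" "x \<le> y" "1 \<le> x" for x y
    using that(2,1,3) by (induction rule: inc_induct) (auto intro: assms(3))
  have "A = {1..Max A}"
    using assms(1,2) False by (auto intro: down[OF Max_in])
  then show ?thesis by (metis card_atLeastAtMost diff_Suc_1)
qed simp

lemma mem_diagram:
  "(c, r) \<in> diagram \<alpha> \<longleftrightarrow> 1 \<le> r \<and> r \<le> length \<alpha> \<and> 1 \<le> c \<and> c \<le> \<alpha> ! (r - 1)"
  by (simp add: diagram_def)

lemma diagram_left: "(c, r) \<in> diagram \<alpha> \<Longrightarrow> 1 \<le> c' \<Longrightarrow> c' \<le> c \<Longrightarrow> (c', r) \<in> diagram \<alpha>"
  by (auto simp: mem_diagram)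

lemma card_diagram: "card (diagram \<alpha>) = sum_list \<alpha>"
proof -
  have "diagram \<alpha> = (\<lambda>(r, c). (c, r)) ` Sigma {1..length \<alpha>} (\<lambda>r. {1..\<alpha> ! (r - 1)})"
    by (auto simp: diagram_def image_iff)
  then have "card (diagram \<alpha>) = (\<Sum>r\<in>{1..length \<alpha>}. \<alpha> ! (r - 1))"
    by (simp add: card_image inj_on_def)
  also have "\<dots> = (\<Sum>i<length \<alpha>. \<alpha> ! i)"
    by (rule sum.reindex_bij_witness[of _ Suc "\<lambda>r. r - 1"]) auto
  finally show ?thesis by (simp add: sum_list_sum_nth atLeast0LessThan)
qed

lemma peak_diagram_second:
  assumes "peak_composition n \<alpha>" "1 \<le> r" "(1, Suc r) \<in> diagram \<alpha>"
  shows "(2, r) \<in> diagram \<alpha>"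
proof -
  have r: "r - 1 < length (butlast \<alpha>)" "1 \<le> r" "r \<le> length \<alpha>"
    using assms(2,3) by (auto simp: mem_diagram)
  then have "\<alpha> ! (r - 1) \<in> set (butlast \<alpha>)" by (metis nth_butlast nth_mem)
  then have "1 < \<alpha> ! (r - 1)" using assms(1) by (auto simp: peak_composition_def)
  with r show ?thesis by (simp add: mem_diagram)
qed

text \<open>Replaces the existential over compositions by conditions on neighbouring boxes. The last
  one says that every row below another has length at least 2; together with closure to the left it
  also rules out gaps in the first column.\<close>

lemma is_peak_diagram_iff:
  "is_peak_diagram E \<longleftrightarrow> finite E \<and> (\<forall>c r. (c, r) \<in> E \<longrightarrow> 1 \<le> c \<and> 1 \<le> r) \<and>
    (\<forall>c r. 1 \<le> c \<and> (Suc c, r) \<in> E \<longrightarrow> (c, r) \<in> E) \<and>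
    (\<forall>r. 1 \<le> r \<and> (1, Suc r) \<in> E \<longrightarrow> (2, r) \<in> E)" (is "?L \<longleftrightarrow> ?R")
proof
  assume ?L
  then obtain m \<beta> where \<beta>: "peak_composition m \<beta>" "E = diagram \<beta>"
    by (auto simp: is_peak_diagram_def)
  then show ?R
    using finite_diagram peak_diagram_second[OF \<beta>(1)] by (auto simp: mem_diagram)
next
  assume R: ?R
  define row where "row r = {c. (c, r) \<in> E}" for r
  have fin: "finite (row r)" for r
  proof -
    have "row r \<subseteq> fst ` E" by (auto simp: row_def intro: rev_image_eqI)
    then show ?thesis using R finite_subset by blast
  qed
  have row: "row r = {1..card (row r)}" for r
    by (rule initial_segment[OF fin]) (use R in \<open>unfold row_def, blast+\<close>)
  have mem_row: "(c, r) \<in> E \<longleftrightarrow> 1 \<le> c \<and> c \<le> card (row r)" for c r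
  proof -
    have "(c, r) \<in> E \<longleftrightarrow> c \<in> row r" by (simp add: row_def)
    also have "\<dots> \<longleftrightarrow> 1 \<le> c \<and> c \<le> card (row r)" by (subst row) simp
    finally show ?thesis .
  qed
  define h where "h = card {r. (1, r) \<in> E}"
  have first: "(1, r) \<in> E" if "(c, r) \<in> E" for c r
    using that mem_row[of c r] mem_row[of 1 r] by simp
  have h: "{r. (1, r) \<in> E} = {1..h}"
    unfolding h_def
  proof (rule initial_segment)
    show "finite {r. (1, r) \<in> E}"
    proof -
      have "{r. (1, r) \<in> E} \<subseteq> snd ` E" by (auto intro: rev_image_eqI)
      then show ?thesis using R finite_subset by blast
    qed
  qed (use R first in blast)+
  define \<beta> where "\<beta> = map (\<lambda>r. card (row r)) [1..<Suc h]"
  then have len: "length \<beta> = h" by simp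
  have nth: "\<beta> ! (r - 1) = card (row r)" if "1 \<le> r" "r \<le> h" for r
    using that by (cases r) (simp_all add: \<beta>_def del: upt_Suc)
  have "E = diagram \<beta>"
  proof (rule set_eqI, rule iffI; clarify)
    fix c r assume cr: "(c, r) \<in> E"
    then have "r \<in> {1..h}" using first h by blast
    moreover have "1 \<le> c \<and> c \<le> card (row r)" using cr mem_row[of c r] by simp
    ultimately show "(c, r) \<in> diagram \<beta>" using nth by (auto simp: mem_diagram len)
  next
    fix c r assume "(c, r) \<in> diagram \<beta>"
    then have r: "1 \<le> r" "r \<le> h" and "1 \<le> c" "c \<le> \<beta> ! (r - 1)"
      by (auto simp: mem_diagram len)
    then show "(c, r) \<in> E" using nth mem_row[of c r] by simp
  qed
  moreover have "0 < card (row r)" if "1 \<le> r" "r \<le> h" for r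
  proof -
    have "r \<in> {r. (1, r) \<in> E}" using that unfolding h by simp
    then show ?thesis using mem_row[of 1 r] by simp
  qed
  then have "composition (sum_list \<beta>) \<beta>"
    by (auto simp: composition_def \<beta>_def)
  moreover have "1 < card (row r)" if "1 \<le> r" "r < h" for r
  proof -
    have "Suc r \<in> {r. (1, r) \<in> E}" using that unfolding h by simp
    then have "(2, r) \<in> E" using R that by blast
    then show ?thesis using mem_row[of 2 r] by simp
  qed
  then have "\<forall>a\<in>set (butlast \<beta>). 1 < a"
    by (cases h) (auto simp: \<beta>_def butlast_append)
  ultimately show ?L by (auto simp: is_peak_diagram_def peak_composition_def)
qed

text \<open>SPYCT without the triple condition (4). The counting arguments work at this generality,
  and the tableaux that fail (4) supply the surplus for the remaining shapes.\<close>

definition standard_peak_tableau :: "nat list \<Rightarrow> (nat \<times> nat \<Rightarrow> nat) \<Rightarrow> bool" where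
  "standard_peak_tableau \<alpha> T \<longleftrightarrow>
    T \<in> extensional (diagram \<alpha>) \<and>
    bij_betw T (diagram \<alpha>) {1..sum_list \<alpha>} \<and>
    (\<forall>c c' r. (c, r) \<in> diagram \<alpha> \<and> (c', r) \<in> diagram \<alpha> \<and> c < c' \<longrightarrow> T (c, r) < T (c', r)) \<and>
    (\<forall>r r'. (1, r) \<in> diagram \<alpha> \<and> (1, r') \<in> diagram \<alpha> \<and> r < r' \<longrightarrow> T (1, r) < T (1, r')) \<and>
    (\<forall>k\<le>sum_list \<alpha>. is_peak_diagram {b \<in> diagram \<alpha>. T b \<le> k})"

lemma SPYCT_iff:
  "T \<in> SPYCT \<alpha> \<longleftrightarrow> standard_peak_tableau \<alpha> T \<and>
    (\<forall>c r r'. (c, r) \<in> diagram \<alpha> \<and> (c + 1, r') \<in> diagram \<alpha> \<and> r' < r \<and>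
       T (c, r) < T (c + 1, r') \<longrightarrow>
       (c + 1, r) \<in> diagram \<alpha> \<and> T (c + 1, r) < T (c + 1, r'))"
  by (simp add: SPYCT_def standard_peak_tableau_def conj_assoc)

text \<open>The chain \<open>T (1, r) < T (2, r) < T (1, Suc r)\<close> gives the increasing first
  column, and by \<open>is_peak_diagram_iff\<close> the same inequalities make every level set a
  peak diagram.\<close>

lemma standard_peak_tableauI:
  assumes \<alpha>: "peak_composition n \<alpha>" and T: "T \<in> extensional (diagram \<alpha>)"
    "bij_betw T (diagram \<alpha>) {1..sum_list \<alpha>}"
    and row: "\<And>c c' r. (c, r) \<in> diagram \<alpha> \<Longrightarrow> (c', r) \<in> diagram \<alpha> \<Longrightarrow> c < c' \<Longrightarrow> T (c, r) < T (c', r)"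
    and next_row: "\<And>r. 1 \<le> r \<Longrightarrow> (1, Suc r) \<in> diagram \<alpha> \<Longrightarrow> T (2, r) < T (1, Suc r)"
  shows "standard_peak_tableau \<alpha> T"
proof -
  have col: "T (1, r) < T (1, r')" if "r < r'" "(1, r) \<in> diagram \<alpha>" "(1, r') \<in> diagram \<alpha>" for r r'
    using that
  proof (induction rule: strict_inc_induct)
    case (base i)
    then have "(2, i) \<in> diagram \<alpha>"
      using peak_diagram_second[OF \<alpha>] by (auto simp: mem_diagram)
    then show ?case using base row[of 1 i 2] next_row[of i] by (fastforce simp: mem_diagram)
  next
    case (step i)
    then have s: "(1, Suc i) \<in> diagram \<alpha>" "1 \<le> i"
      using \<alpha> by (auto simp: mem_diagram peak_composition_def composition_def Suc_le_eq)
    then have "(2, i) \<in> diagram \<alpha>"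
      using peak_diagram_second[OF \<alpha>] by blast
    then show ?case using s step row[of 1 i 2] next_row[of i] by fastforce
  qed
  have "is_peak_diagram {b \<in> diagram \<alpha>. T b \<le> k}" for k
    unfolding is_peak_diagram_iff
  proof (intro conjI allI impI)
    fix c r assume cr: "1 \<le> c \<and> (Suc c, r) \<in> {b \<in> diagram \<alpha>. T b \<le> k}"
    then have "(c, r) \<in> diagram \<alpha>" by (auto intro: diagram_left)
    then show "(c, r) \<in> {b \<in> diagram \<alpha>. T b \<le> k}" using cr row[of c r "Suc c"] by auto
  next
    fix r assume r: "1 \<le> r \<and> (1, Suc r) \<in> {b \<in> diagram \<alpha>. T b \<le> k}"
    then have "(2, r) \<in> diagram \<alpha>" using peak_diagram_second[OF \<alpha>] by auto
    then show "(2, r) \<in> {b \<in> diagram \<alpha>. T b \<le> k}" using r next_row[of r] by auto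
  qed (auto simp: finite_diagram mem_diagram)
  with T row col show ?thesis by (auto simp: standard_peak_tableau_def)
qed

lemma standard_peak_tableauD:
  assumes "standard_peak_tableau \<alpha> T"
  shows "bij_betw T (diagram \<alpha>) {1..sum_list \<alpha>}"
    and "(c, r) \<in> diagram \<alpha> \<Longrightarrow> (c', r) \<in> diagram \<alpha> \<Longrightarrow> c < c' \<Longrightarrow> T (c, r) < T (c', r)"
    and "(1, r) \<in> diagram \<alpha> \<Longrightarrow> (1, r') \<in> diagram \<alpha> \<Longrightarrow> r < r' \<Longrightarrow> T (1, r) < T (1, r')"
  using assms by (auto simp: standard_peak_tableau_def)

text \<open>Condition (3) at level \<open>T (1, Suc r)\<close>: once a row is opened, the row below
  it must already contain its second box. Higher rows follow from the increasing first
  column.\<close>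

lemma standard_next_row:
  assumes T: "standard_peak_tableau \<alpha> T" and r: "1 \<le> r" "r < r'" "(1, r') \<in> diagram \<alpha>"
    and \<alpha>: "peak_composition n \<alpha>"
  shows "(2, r) \<in> diagram \<alpha>" "T (2, r) < T (1, r')"
proof -
  have s: "(1, Suc r) \<in> diagram \<alpha>"
    using r \<alpha> by (auto simp: mem_diagram peak_composition_def composition_def Suc_le_eq)
  show 2: "(2, r) \<in> diagram \<alpha>" using peak_diagram_second[OF \<alpha> r(1) s] .
  let ?k = "T (1, Suc r)"
  have bij: "bij_betw T (diagram \<alpha>) {1..sum_list \<alpha>}" using standard_peak_tableauD(1)[OF T] .
  then have "?k \<in> {1..sum_list \<alpha>}" using s by (rule bij_betwE[rule_format])
  then have "is_peak_diagram {b \<in> diagram \<alpha>. T b \<le> ?k}"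
    using T by (auto simp: standard_peak_tableau_def)
  then have "T (2, r) \<le> ?k" using r(1) s unfolding is_peak_diagram_iff by blast
  moreover have "T (2, r) \<noteq> ?k"
    using bij s 2 unfolding bij_betw_def inj_on_def by fastforce
  moreover have "?k \<le> T (1, r')"
    using standard_peak_tableauD(3)[OF T s r(3)] r by (cases "Suc r = r'") auto
  ultimately show "T (2, r) < T (1, r')" by simp
qed

text \<open>These are Stembridge's enriched partitions of a chain, namely the boxes in the order of
  \<open>T\<close>: equal marked letters are allowed only at descents, equal unmarked letters only
  at ascents.\<close>

definition compatible :: "nat list \<Rightarrow> (nat \<times> nat \<Rightarrow> nat) \<Rightarrow> (nat \<times> nat \<Rightarrow> letter) \<Rightarrow> bool" where
  "compatible \<alpha> T f \<longleftrightarrow> (\<forall>b\<in>diagram \<alpha>. \<forall>b'\<in>diagram \<alpha>. T b' = Suc (T b) \<longrightarrow> f b \<le> f b' \<and>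
    (f b = f b' \<longrightarrow> (if is_Marked (f b) then fst b' \<le> fst b else fst b < fst b')))"

text \<open>If the letters at both ends agree, monotonicity makes all letters in between agree too,
  so the column comparisons of the consecutive steps compose.\<close>

lemma compatible_less:
  assumes f: "compatible \<alpha> T f" and bij: "bij_betw T (diagram \<alpha>) {1..N}"
    and b: "b \<in> diagram \<alpha>" "b' \<in> diagram \<alpha>" "T b < T b'"
  shows "f b \<le> f b' \<and> (f b = f b' \<longrightarrow> (if is_Marked (f b) then fst b' \<le> fst b else fst b < fst b'))"
  using b(2,3)
proof (induction "T b'" arbitrary: b' rule: less_induct)
  case less
  show ?case
  proof (cases "T b' = Suc (T b)")
    case True
    then show ?thesis using f b(1) less.prems unfolding compatible_def by blast
  next
    case False
    have "T b' \<in> {1..N}" using bij less.prems(1) by (rule bij_betwE[rule_format])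
    then have "T b' - 1 \<in> {1..N}" using False less.prems by auto
    then obtain d where d: "d \<in> diagram \<alpha>" "T d = T b' - 1"
      using bij by (metis bij_betw_imp_surj_on imageE)
    then have T: "T b' = Suc (T d)" "T b < T d" using False less.prems by auto
    then have 1: "f b \<le> f d \<and> (f b = f d \<longrightarrow> (if is_Marked (f b) then fst d \<le> fst b else fst b < fst d))"
      using less.hyps[of d] d by auto
    have 2: "f d \<le> f b' \<and> (f d = f b' \<longrightarrow> (if is_Marked (f d) then fst b' \<le> fst d else fst d < fst b'))"
      using f d T less.prems unfolding compatible_def by blast
    show ?thesis
    proof (intro conjI impI)
      show "f b \<le> f b'" using 1 2 by auto
      assume "f b = f b'"
      then have "f b = f d" "f d = f b'" using 1 2 by auto
      then show "if is_Marked (f b) then fst b' \<le> fst b else fst b < fst b'"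
        using 1 2 by (auto split: if_splits)
    qed
  qed
qed

lemma letter_val_mono: "x \<le> y \<Longrightarrow> letter_val x \<le> letter_val y"
  by (cases x; cases y) (auto simp: less_eq_letter_def)

lemma letter_less_iff: "x < y \<longleftrightarrow> letter_val x < letter_val y \<or>
    letter_val x = letter_val y \<and> is_Marked x \<and> \<not> is_Marked y"
  by (cases x; cases y) (auto simp: less_letter_def)

text \<open>Each condition compares two boxes whose order in \<open>T\<close> is known, either
  within a row or from \<open>(2, r)\<close> to the first box of a higher row. A move to the right
  excludes equal marked letters, a move to the left equal unmarked ones.\<close>

lemma compatible_imp_marked_peak_tableau:
  assumes \<alpha>: "peak_composition n \<alpha>" and T: "standard_peak_tableau \<alpha> T" and f: "compatible \<alpha> T f"
    and ext: "f \<in> extensional (diagram \<alpha>)" and pos: "\<And>b. b \<in> diagram \<alpha> \<Longrightarrow> 1 \<le> letter_val (f b)"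
  shows "marked_peak_tableau \<alpha> f"
proof -
  note less = compatible_less[OF f standard_peak_tableauD(1)[OF T]]
  note row = standard_peak_tableauD(2)[OF T]
  note next_row = standard_next_row[OF T _ _ _ \<alpha>]
  have "f (c, r) \<le> f (c', r) \<and> (\<forall>i. \<not> (f (c, r) = Marked i \<and> f (c', r) = Marked i))"
    if "(c, r) \<in> diagram \<alpha>" "(c', r) \<in> diagram \<alpha>" "c < c'" for c c' r
    using less[OF that(1,2) row[OF that]] that by auto
  \<comment> \<open>The route through \<open>(2, r)\<close> goes right and then left, so a letter
    constant along it could be neither marked nor unmarked.\<close>
  moreover have "f (1, r) < f (1, r')"
    if r: "(1, r) \<in> diagram \<alpha>" "(1, r') \<in> diagram \<alpha>" "r < r'" for r r'
  proof -
    have 2: "(2, r) \<in> diagram \<alpha>" "T (2, r) < T (1, r')"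
      using next_row r by (auto simp: mem_diagram)
    have "T (1, r) < T (2, r)" using row r 2 by auto
    from less[OF r(1) 2(1) this] less[OF 2(1) r(2) 2(2)] show ?thesis
      by (cases "f (1, r) = f (1, r')") (auto split: if_splits)
  qed
  moreover have "is_peak_diagram {b \<in> diagram \<alpha>. letter_val (f b) \<le> k}" for k
    unfolding is_peak_diagram_iff
  proof (intro conjI allI impI)
    fix c r assume cr: "1 \<le> c \<and> (Suc c, r) \<in> {b \<in> diagram \<alpha>. letter_val (f b) \<le> k}"
    then have "(c, r) \<in> diagram \<alpha>" by (auto intro: diagram_left)
    then show "(c, r) \<in> {b \<in> diagram \<alpha>. letter_val (f b) \<le> k}"
      using cr row[of c r "Suc c"] less[of "(c, r)" "(Suc c, r)"] letter_val_mono by fastforce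
  next
    fix r assume r: "1 \<le> r \<and> (1, Suc r) \<in> {b \<in> diagram \<alpha>. letter_val (f b) \<le> k}"
    then have 2: "(2, r) \<in> diagram \<alpha>" "T (2, r) < T (1, Suc r)" using next_row by auto
    with r less[OF 2(1) _ 2(2)] have "f (2, r) \<le> f (1, Suc r)" by auto
    then show "(2, r) \<in> {b \<in> diagram \<alpha>. letter_val (f b) \<le> k}"
      using r 2 letter_val_mono by fastforce
  qed (auto simp: finite_diagram mem_diagram)
  moreover have "f (1, r + 1) \<noteq> Unmarked i \<and> f (1, r + 1) \<noteq> Marked i"
    if r: "(2, r) \<in> diagram \<alpha>" "(1, r + 1) \<in> diagram \<alpha>" "f (2, r) = Unmarked i" for i r
  proof -
    have "T (2, r) < T (1, r + 1)" using next_row[of r "r + 1"] r by (auto simp: mem_diagram)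
    note less = less[OF r(1,2) this]
    have "f (2, r) \<noteq> f (1, r + 1)"
    proof
      assume "f (2, r) = f (1, r + 1)"
      with less r(3) show False
          by (metis letter.disc(2) fst_conv one_less_numeral_iff not_less_iff_gr_or_eq semiring_norm(76))
    qed
    \<comment> \<open>The unmarked letter is the largest of its value, so any larger letter has a
      larger value.\<close>
    with less have "f (2, r) < f (1, r + 1)" by auto
    then show ?thesis using r(3) by (auto simp: letter_less_iff)
  qed
  ultimately show ?thesis using ext pos by (auto simp: marked_peak_tableau_def)
qed

section \<open>Standardization\<close>

definition rank_filling :: "'b set \<Rightarrow> ('b \<Rightarrow> 'k::linorder) \<Rightarrow> 'b \<Rightarrow> nat" where
  "rank_filling D key = restrict (\<lambda>b. card {d \<in> D. key d \<le> key b}) D"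

lemma rank_filling_less:
  assumes "finite D" "b \<in> D" "b' \<in> D" "key b < key b'"
  shows "rank_filling D key b < rank_filling D key b'"
proof -
  have "{d \<in> D. key d \<le> key b} \<subset> {d \<in> D. key d \<le> key b'}"
  proof
    show "{d \<in> D. key d \<le> key b} \<subseteq> {d \<in> D. key d \<le> key b'}" using assms by auto
    have "b' \<in> {d \<in> D. key d \<le> key b'} - {d \<in> D. key d \<le> key b}" using assms by auto
    then show "{d \<in> D. key d \<le> key b} \<noteq> {d \<in> D. key d \<le> key b'}" by blast
  qed
  then show ?thesis using assms by (simp add: rank_filling_def psubset_card_mono)
qed

lemma rank_filling_less_iff:
  assumes "finite D" "inj_on key D" "b \<in> D" "b' \<in> D"
  shows "rank_filling D key b < rank_filling D key b' \<longleftrightarrow> key b < key b'"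
  using rank_filling_less[of D b b' key] rank_filling_less[of D b' b key] assms
  by (metis inj_onD less_asym neqE)

lemma bij_betw_rank_filling:
  assumes "finite D" "inj_on key D"
  shows "bij_betw (rank_filling D key) D {1..card D}"
proof -
  have inj: "inj_on (rank_filling D key) D"
    using rank_filling_less_iff[OF assms] assms(2)
    by (metis inj_onD inj_onI less_irrefl neqE)
  have "rank_filling D key ` D \<subseteq> {1..card D}"
  proof
    fix x assume "x \<in> rank_filling D key ` D"
    then obtain b where b: "b \<in> D" "x = card {d \<in> D. key d \<le> key b}"
      by (auto simp: rank_filling_def)
    then have "{d \<in> D. key d \<le> key b} \<noteq> {}" by auto
    then show "x \<in> {1..card D}"
      using assms(1) b by (auto simp: Suc_le_eq card_gt_0_iff intro: card_mono)
  qed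
  moreover have "card (rank_filling D key ` D) = card {1..card D}"
    using inj by (simp add: card_image)
  ultimately show ?thesis
    using inj by (simp add: bij_betw_def card_subset_eq)
qed

text \<open>A monotone bijection has the same boxes below \<open>b\<close> as the key does, and its
  value at \<open>b\<close> is the number of these boxes.\<close>

lemma rank_filling_unique:
  assumes "finite D" "inj_on key D" "bij_betw T D {1..card D}" "T \<in> extensional D"
    and mono: "\<And>b b'. b \<in> D \<Longrightarrow> b' \<in> D \<Longrightarrow> key b < key b' \<Longrightarrow> T b < T b'"
  shows "T = rank_filling D key"
proof (rule extensionalityI[OF assms(4)])
  show "rank_filling D key \<in> extensional D" by (simp add: rank_filling_def)
  fix b assume b: "b \<in> D"
  have inj: "inj_on T D" and im: "T ` D = {1..card D}" using assms(3) by (auto simp: bij_betw_def)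
  have "T d \<le> T b \<longleftrightarrow> key d \<le> key b" if "d \<in> D" for d
    using mono[of d b] mono[of b d] that b assms(2)
    by (metis inj_onD leD leI nle_le order_less_imp_le)
  then have "rank_filling D key b = card {d \<in> D. T d \<le> T b}"
    using b by (auto simp: rank_filling_def intro!: arg_cong[of _ _ card])
  also have "\<dots> = card (T ` {d \<in> D. T d \<le> T b})"
    by (rule card_image[symmetric]) (use inj in \<open>auto intro: inj_on_subset\<close>)
  also have "T ` {d \<in> D. T d \<le> T b} = {1..T b}"
  proof -
    have "T b \<le> card D" using im b by auto
    then have "{1..T b} \<subseteq> T ` D" unfolding im by simp
    moreover have "1 \<le> T d" if "d \<in> D" for d using im that by auto
    ultimately show ?thesis by fastforce
  qed
  finally show "T b = rank_filling D key b" by simp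
qed

text \<open>Equal marked letters are read from right to left, hence the negated column, and equal
  unmarked letters from left to right, as compatibility demands. The row breaks ties within a
  column, from bottom to top.\<close>

definition tableau_key :: "(nat \<times> nat \<Rightarrow> letter) \<Rightarrow> nat \<times> nat \<Rightarrow> letter \<times> int \<times> nat" where
  "tableau_key f b = (f b, if is_Marked (f b) then - int (fst b) else int (fst b), snd b)"

lemma inj_on_tableau_key: "inj_on (tableau_key f) D"
  by (auto simp: inj_on_def tableau_key_def)

lemma tableau_key_less_iff: "tableau_key f b < tableau_key f b' \<longleftrightarrow> f b < f b' \<or> f b = f b' \<and>
    ((if is_Marked (f b) then fst b' < fst b else fst b < fst b') \<or> fst b = fst b' \<and> snd b < snd b')"
  by (auto simp: tableau_key_def less_prod_def')

section \<open>Values and inequalities in marked tableaux\<close>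

lemma weight_eq: "weight \<alpha> f i = card {b \<in> diagram \<alpha>. letter_val (f b) = i}"
proof -
  have "f b = Unmarked i \<or> f b = Marked i \<longleftrightarrow> letter_val (f b) = i" for b
    by (cases "f b") auto
  then show ?thesis by (simp add: weight_def)
qed

lemma weight_nonzero_iff: "weight \<alpha> f i \<noteq> 0 \<longleftrightarrow> i \<in> (letter_val \<circ> f) ` diagram \<alpha>"
  by (auto simp: weight_eq finite_diagram)

lemma MPCT_iff:
  "f \<in> MPCT \<alpha> \<longleftrightarrow> marked_peak_tableau \<alpha> f \<and> (\<exists>L. (letter_val \<circ> f) ` diagram \<alpha> = {1..L})"
proof
  let ?V = "(letter_val \<circ> f) ` diagram \<alpha>"
  assume f: "f \<in> MPCT \<alpha>"
  have "?V = {1..card ?V}"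
  proof (rule initial_segment)
    show "1 \<le> x" if "x \<in> ?V" for x
      using f that by (auto simp: MPCT_def marked_peak_tableau_def)
    show "x \<in> ?V" if "1 \<le> x" "Suc x \<in> ?V" for x
      using f that unfolding MPCT_def weight_nonzero_iff by blast
  qed (simp add: finite_diagram)
  then show "marked_peak_tableau \<alpha> f \<and> (\<exists>L. ?V = {1..L})"
    using f by (auto simp: MPCT_def)
next
  assume "marked_peak_tableau \<alpha> f \<and> (\<exists>L. (letter_val \<circ> f) ` diagram \<alpha> = {1..L})"
  then obtain L where tab: "marked_peak_tableau \<alpha> f" and L: "(letter_val \<circ> f) ` diagram \<alpha> = {1..L}"
    by blast
  have "weight \<alpha> f i \<noteq> 0" if "1 \<le> i" "i < j" "weight \<alpha> f j \<noteq> 0" for i j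
    using that unfolding weight_nonzero_iff L by simp
  with tab show "f \<in> MPCT \<alpha>" unfolding MPCT_def by blast
qed

text \<open>The counterpart of \<open>standard_next_row\<close>: condition (3) at the level of the
  value in \<open>(1, Suc r)\<close> gives the weak inequality, and (4) excludes equality after an
  unmarked letter. That level is within the range of (3) because \<open>L\<close> values without
  gaps occupy at least \<open>L\<close> boxes.\<close>

lemma MPCT_next_row:
  assumes \<alpha>: "peak_composition n \<alpha>" and f: "f \<in> MPCT \<alpha>" and r: "1 \<le> r" "(1, Suc r) \<in> diagram \<alpha>"
  shows "letter_val (f (2, r)) \<le> letter_val (f (1, Suc r))"
    and "\<not> is_Marked (f (2, r)) \<Longrightarrow> letter_val (f (2, r)) < letter_val (f (1, Suc r))"
proof -
  let ?k = "letter_val (f (1, Suc r))"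
  obtain L where L: "(letter_val \<circ> f) ` diagram \<alpha> = {1..L}" and tab: "marked_peak_tableau \<alpha> f"
    using f by (auto simp: MPCT_iff)
  have "L = card ((letter_val \<circ> f) ` diagram \<alpha>)" unfolding L by simp
  also have "\<dots> \<le> sum_list \<alpha>" by (metis card_diagram card_image_le finite_diagram)
  finally have "L \<le> sum_list \<alpha>" .
  moreover have "?k \<in> {1..L}" using r(2) unfolding L[symmetric] by auto
  ultimately have "is_peak_diagram {b \<in> diagram \<alpha>. letter_val (f b) \<le> ?k}"
    using tab by (auto simp: marked_peak_tableau_def)
  then have "(2, r) \<in> {b \<in> diagram \<alpha>. letter_val (f b) \<le> ?k}"
    using r unfolding is_peak_diagram_iff by blast
  then show le: "letter_val (f (2, r)) \<le> ?k" by simp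
  assume "\<not> is_Marked (f (2, r))"
  then obtain i where i: "f (2, r) = Unmarked i" by (cases "f (2, r)") auto
  then have "f (1, Suc r) \<noteq> Unmarked i \<and> f (1, Suc r) \<noteq> Marked i"
    using tab r peak_diagram_second[OF \<alpha> r] by (auto simp: marked_peak_tableau_def)
  then have "?k \<noteq> i" by (cases "f (1, Suc r)") auto
  with le i show "letter_val (f (2, r)) < ?k" by simp
qed

text \<open>The geometric form of the listed shapes, as \<open>narrow_iff\<close> shows. All boxes
  beyond the second column then lie in a single row.\<close>

definition narrow :: "nat list \<Rightarrow> bool" where
  "narrow \<alpha> \<longleftrightarrow> (\<forall>r r'. r' < r \<and> (3, r') \<in> diagram \<alpha> \<longrightarrow> (2, r) \<notin> diagram \<alpha>)"

lemma narrow_diagram: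
  assumes "narrow \<alpha>" "(c, r') \<in> diagram \<alpha>" "3 \<le> c" "(d, r) \<in> diagram \<alpha>" "2 \<le> d"
  shows "r \<le> r'"
proof (rule ccontr)
  assume "\<not> r \<le> r'"
  then have "r' < r" by simp
  moreover have "(3, r') \<in> diagram \<alpha>" using assms(3) by (intro diagram_left[OF assms(2)]) auto
  moreover have "(2, r) \<in> diagram \<alpha>" using assms(5) by (intro diagram_left[OF assms(4)]) auto
  ultimately show False using assms(1) unfolding narrow_def by blast
qed

text \<open>The premises of (4) never hold: for \<open>c = 1\<close> they contradict
  \<open>standard_next_row\<close>, and for \<open>c \<ge> 2\<close> the required boxes contradict
  narrowness.\<close>

lemma narrow_SPYCT_iff:
  assumes \<alpha>: "peak_composition n \<alpha>" and nar: "narrow \<alpha>"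
  shows "T \<in> SPYCT \<alpha> \<longleftrightarrow> standard_peak_tableau \<alpha> T"
proof -
  have False if T: "standard_peak_tableau \<alpha> T"
    and b: "(c, r) \<in> diagram \<alpha>" "(c + 1, r') \<in> diagram \<alpha>" "r' < r" "T (c, r) < T (c + 1, r')" for T c r r'
  proof (cases "c = 1")
    case True
    have "T (2, r') < T (1, r)"
      using standard_next_row(2)[OF T _ b(3) _ \<alpha>] b(1,2) True by (auto simp: mem_diagram)
    then show False using b(4) True by (simp add: numeral_2_eq_2)
  next
    case False
    then show False using narrow_diagram[OF nar b(2) _ b(1)] b by (auto simp: mem_diagram)
  qed
  then show ?thesis unfolding SPYCT_iff by blast
qed

text \<open>Justifies the tie-break by row in the uniqueness of standardization. A column beyond the
  second has only one box, and in column 2 the comparison passes through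
  \<open>(1, r')\<close>.\<close>

lemma standard_same_column:
  assumes \<alpha>: "peak_composition n \<alpha>" and nar: "narrow \<alpha>" and T: "standard_peak_tableau \<alpha> T"
    and b: "(c, r) \<in> diagram \<alpha>" "(c, r') \<in> diagram \<alpha>" "r < r'"
  shows "T (c, r) < T (c, r')"
proof -
  have "1 \<le> c" "1 \<le> r" using b by (auto simp: mem_diagram)
  moreover have "\<not> 3 \<le> c" using narrow_diagram[OF nar b(1) _ b(2)] b(3) by auto
  ultimately consider "c = 1" | "c = 2" by linarith
  then show ?thesis
  proof cases
    case 1
    then show ?thesis using standard_peak_tableauD(3)[OF T] b by auto
  next
    case 2
    then have "(1, r') \<in> diagram \<alpha>" using b diagram_left[of 2 r' \<alpha> 1] by simp
    then show ?thesis
      using standard_next_row(2)[OF T \<open>1 \<le> r\<close> b(3) _ \<alpha>] standard_peak_tableauD(2)[OF T, of 1 r' 2] b 2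
      by fastforce
  qed
qed

text \<open>Needed for the existence of a standardization, as equal unmarked letters must move
  strictly right. In column 2 the values rise strictly from \<open>(2, r)\<close> to
  \<open>(1, Suc r)\<close> and then weakly through \<open>(1, r')\<close> to
  \<open>(2, r')\<close>.\<close>

lemma MPCT_same_column_unmarked:
  assumes \<alpha>: "peak_composition n \<alpha>" and nar: "narrow \<alpha>" and f: "f \<in> MPCT \<alpha>"
    and b: "(c, r) \<in> diagram \<alpha>" "(c, r') \<in> diagram \<alpha>" "r < r'" "\<not> is_Marked (f (c, r))"
  shows "f (c, r) \<noteq> f (c, r')"
proof -
  have tab: "marked_peak_tableau \<alpha> f" using f by (simp add: MPCT_iff)
  have "1 \<le> c" "1 \<le> r" using b by (auto simp: mem_diagram)
  moreover have "\<not> 3 \<le> c" using narrow_diagram[OF nar b(1) _ b(2)] b(3) by auto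
  ultimately consider "c = 1" | "c = 2" by linarith
  then show ?thesis
  proof cases
    case 1
    then have "f (c, r) < f (c, r')" using tab b unfolding marked_peak_tableau_def by blast
    then show ?thesis by simp
  next
    case 2
    have r': "(1, r') \<in> diagram \<alpha>" using b 2 diagram_left[of 2 r' \<alpha> 1] by simp
    have s: "(1, Suc r) \<in> diagram \<alpha>"
      using b(3) r' \<alpha> by (auto simp: mem_diagram peak_composition_def composition_def Suc_le_eq)
    have "letter_val (f (2, r)) < letter_val (f (1, Suc r))"
      using MPCT_next_row(2)[OF \<alpha> f \<open>1 \<le> r\<close> s] b(4) 2 by simp
    also have "f (1, Suc r) \<le> f (1, r')"
      using tab s r' b(3) unfolding marked_peak_tableau_def
      by (metis Suc_lessI order_less_imp_le order_refl)
    then have "letter_val (f (1, Suc r)) \<le> letter_val (f (1, r'))" by (rule letter_val_mono)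
    also have "f (1, r') \<le> f (2, r')"
      using tab r' b(2) 2 unfolding marked_peak_tableau_def by (metis one_less_numeral_iff semiring_norm(76))
    then have "letter_val (f (1, r')) \<le> letter_val (f (2, r'))" by (rule letter_val_mono)
    finally show ?thesis using 2 by auto
  qed
qed

text \<open>Existence comes from ranking the boxes by \<open>tableau_key\<close>. Uniqueness holds
  because compatibility fixes the order of any two boxes except equal marked letters in one column,
  and for those the shape fixes it.\<close>

lemma MPCT_standardization:
  assumes \<alpha>: "peak_composition n \<alpha>" and nar: "narrow \<alpha>" and f: "f \<in> MPCT \<alpha>"
  shows "\<exists>!T. T \<in> SPYCT \<alpha> \<and> compatible \<alpha> T f"
proof -
  let ?D = "diagram \<alpha>" and ?key = "tableau_key f"
  define R where "R = rank_filling ?D ?key"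
  have tab: "marked_peak_tableau \<alpha> f" using f by (simp add: MPCT_iff)
  note less_iff = rank_filling_less_iff[OF finite_diagram inj_on_tableau_key, of _ \<alpha> _ f, folded R_def]
  have R: "R \<in> extensional ?D" "bij_betw R ?D {1..sum_list \<alpha>}"
    using bij_betw_rank_filling[OF finite_diagram inj_on_tableau_key, of \<alpha> f]
    by (auto simp: R_def rank_filling_def card_diagram)
  have std: "standard_peak_tableau \<alpha> R"
  proof (rule standard_peak_tableauI[OF \<alpha> R])
    fix c c' r assume c: "(c, r) \<in> ?D" "(c', r) \<in> ?D" "c < c'"
    then have "f (c, r) \<le> f (c', r) \<and> (\<forall>i. \<not> (f (c, r) = Marked i \<and> f (c', r) = Marked i))"
      using tab unfolding marked_peak_tableau_def by blast
    then have "?key (c, r) < ?key (c', r)"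
      using c(3) by (cases "f (c, r)"; cases "f (c', r)")
        (auto simp: tableau_key_less_iff less_eq_letter_def less_letter_def, presburger+)
    then show "R (c, r) < R (c', r)" using less_iff c by blast
  next
    fix r assume r: "1 \<le> r" "(1, Suc r) \<in> ?D"
    have "?key (2, r) < ?key (1, Suc r)"
      using MPCT_next_row[OF \<alpha> f r] by (cases "f (2, r)"; cases "f (1, Suc r)")
        (auto simp: tableau_key_less_iff letter_less_iff)
    then show "R (2, r) < R (1, Suc r)" using less_iff r peak_diagram_second[OF \<alpha> r] by blast
  qed
  have comp: "compatible \<alpha> R f"
    unfolding compatible_def
  proof (intro ballI impI)
    fix b b' assume b: "b \<in> ?D" "b' \<in> ?D" "R b' = Suc (R b)"
    then have key: "?key b < ?key b'" using less_iff[of b b'] by simp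
    show "f b \<le> f b' \<and> (f b = f b' \<longrightarrow> (if is_Marked (f b) then fst b' \<le> fst b else fst b < fst b'))"
    proof (intro conjI impI)
      show "f b \<le> f b'" using key by (auto simp: tableau_key_less_iff)
      assume eq: "f b = f b'"
      \<comment> \<open>The key orders columns only weakly here, whereas compatibility asks for a
        strict move.\<close>
      have "fst b \<noteq> fst b'" if "\<not> is_Marked (f b)"
      proof
        assume c: "fst b = fst b'"
        then have "snd b < snd b'" using key eq that by (auto simp: tableau_key_less_iff)
        then show False
          using MPCT_same_column_unmarked[OF \<alpha> nar f, of "fst b" "snd b" "snd b'"] b c that eq
          by (metis prod.collapse)
      qed
      then show "if is_Marked (f b) then fst b' \<le> fst b else fst b < fst b'"
        using key eq by (auto simp: tableau_key_less_iff split: if_splits)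
    qed
  qed
  show ?thesis
  proof (rule ex1I[of _ R])
    show "R \<in> SPYCT \<alpha> \<and> compatible \<alpha> R f"
      using comp std narrow_SPYCT_iff[OF \<alpha> nar] by blast
    fix T assume "T \<in> SPYCT \<alpha> \<and> compatible \<alpha> T f"
    then have T: "standard_peak_tableau \<alpha> T" "compatible \<alpha> T f"
      using narrow_SPYCT_iff[OF \<alpha> nar] by auto
    have bij: "bij_betw T ?D {1..sum_list \<alpha>}" using standard_peak_tableauD(1)[OF T(1)] .
    show "T = R"
      unfolding R_def
    proof (rule rank_filling_unique[OF finite_diagram inj_on_tableau_key])
      show "bij_betw T ?D {1..card ?D}" using bij by (simp add: card_diagram)
      show "T \<in> extensional ?D" using T(1) by (simp add: standard_peak_tableau_def)
      fix b b' assume b: "b \<in> ?D" "b' \<in> ?D" "?key b < ?key b'"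
      show "T b < T b'"
      proof (rule ccontr)
        assume "\<not> T b < T b'"
        moreover have "T b \<noteq> T b'"
          using b bij by (metis bij_betw_imp_inj_on inj_onD less_irrefl)
        ultimately have lt: "T b' < T b" by simp
        \<comment> \<open>Reversing the key order is possible only for equal marked letters in the
          same column; an unmarked pair would have to move both ways.\<close>
        note c = compatible_less[OF T(2) bij b(2,1) lt]
        then have eq: "f b = f b'" using b(3) by (auto simp: tableau_key_less_iff)
        then have col: "fst b = fst b'" "snd b < snd b'"
          using b(3) c by (auto simp: tableau_key_less_iff split: if_splits)
        then have "T b < T b'"
          using standard_same_column[OF \<alpha> nar T(1), of "fst b" "snd b" "snd b'"] b
          by (metis prod.collapse)
        with lt show False by simp
      qed
    qed
  qed
qed

section \<open>Counting marked tableaux of given weight\<close>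

text \<open>Here \<open>w\<close> lists the values of a filling in the order of a standard tableau.
  A partial sum of \<open>\<gamma>\<close> counts the positions of value at most \<open>j\<close>,
  an initial segment by monotonicity, and this segment ends exactly where \<open>w\<close> rises
  above \<open>j\<close>.\<close>

lemma word_weights:
  fixes w :: "nat \<Rightarrow> nat"
  assumes n: "0 < n" and mono: "\<And>i j. 1 \<le> i \<Longrightarrow> i \<le> j \<Longrightarrow> j \<le> n \<Longrightarrow> w i \<le> w j"
    and im: "w ` {1..n} = {1..L}"
  defines "\<gamma> \<equiv> map (\<lambda>v. card {i \<in> {1..n}. w i = v}) [1..<Suc L]"
  shows "composition n \<gamma>" and "comp_set \<gamma> = {i \<in> {1..<n}. w i < w (Suc i)}"
proof -
  have range: "1 \<le> w i" "w i \<le> L" if "1 \<le> i" "i \<le> n" for i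
  proof -
    have "w i \<in> w ` {1..n}" using that by simp
    then show "1 \<le> w i" "w i \<le> L" unfolding im by auto
  qed
  have sum: "sum_list (take j \<gamma>) = card {i \<in> {1..n}. w i \<le> j}" if "j \<le> L" for j
  proof -
    have "take j \<gamma> = map (\<lambda>v. card {i \<in> {1..n}. w i = v}) [1..<Suc j]"
      using that by (simp add: \<gamma>_def take_map del: upt_Suc)
    then have "sum_list (take j \<gamma>) = (\<Sum>v\<in>{1..j}. card {i \<in> {1..n}. w i = v})"
      by (simp add: interv_sum_list_conv_sum_set_nat atLeastLessThanSuc_atLeastAtMost del: upt_Suc)
    also have "\<dots> = card (\<Union>v\<in>{1..j}. {i \<in> {1..n}. w i = v})"
      by (rule card_UN_disjoint[symmetric]) auto
    also have "(\<Union>v\<in>{1..j}. {i \<in> {1..n}. w i = v}) = {i \<in> {1..n}. w i \<le> j}"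
      using range by auto
    finally show ?thesis .
  qed
  have len: "length \<gamma> = L" by (simp add: \<gamma>_def)
  show "composition n \<gamma>"
    unfolding composition_def
  proof
    have "0 < card {i \<in> {1..n}. w i = v}" if "v \<in> {1..L}" for v
      using that unfolding im[symmetric] by (auto simp: card_gt_0_iff)
    then show "\<forall>a\<in>set \<gamma>. 0 < a" by (auto simp: \<gamma>_def simp del: upt_Suc)
    have "{i \<in> {1..n}. w i \<le> L} = {1..n}" using range by auto
    then show "sum_list \<gamma> = n" using sum[of L] len by simp
  qed
  show "comp_set \<gamma> = {i \<in> {1..<n}. w i < w (Suc i)}"
  proof (intro subset_antisym subsetI)
    fix x assume "x \<in> comp_set \<gamma>"
    then obtain j where j: "x = card {i \<in> {1..n}. w i \<le> j}" "1 \<le> j" "j < L"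
      using sum len by (auto simp: comp_set_def)
    have "{i \<in> {1..n}. w i \<le> j} = {1..card {i \<in> {1..n}. w i \<le> j}}"
    proof (rule initial_segment)
      fix i assume "1 \<le> i" "Suc i \<in> {i \<in> {1..n}. w i \<le> j}"
      then show "i \<in> {i \<in> {1..n}. w i \<le> j}" using mono[of i "Suc i"] by auto
    qed auto
    then have seg: "{i \<in> {1..n}. w i \<le> j} = {1..x}" using j(1) by simp
    have "j \<in> w ` {1..n}" "L \<in> w ` {1..n}" unfolding im using j by auto
    then obtain p q where p: "p \<in> {1..n}" "w p = j" and q: "q \<in> {1..n}" "w q = L" by auto
    have "p \<in> {1..x}" unfolding seg[symmetric] using p by simp
    then have x1: "1 \<le> x" by simp
    have "q \<notin> {1..x}" unfolding seg[symmetric] using q j by simp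
    then have xn: "x < n" using q by auto
    have "x \<in> {i \<in> {1..n}. w i \<le> j}" "Suc x \<notin> {i \<in> {1..n}. w i \<le> j}"
      unfolding seg using x1 by auto
    then show "x \<in> {i \<in> {1..<n}. w i < w (Suc i)}" using x1 xn by auto
  next
    fix x assume "x \<in> {i \<in> {1..<n}. w i < w (Suc i)}"
    then have x: "1 \<le> x" "x < n" "w x < w (Suc x)" by auto
    have "{i \<in> {1..n}. w i \<le> w x} = {1..x}"
    proof (intro subset_antisym subsetI)
      fix i assume i: "i \<in> {i \<in> {1..n}. w i \<le> w x}"
      then have "\<not> Suc x \<le> i" using mono[of "Suc x" i] x by auto
      then show "i \<in> {1..x}" using i by auto
    qed (use mono x in auto)
    then have "x = sum_list (take (w x) \<gamma>)" using sum[of "w x"] range[of x] x by simp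
    moreover have "w x < length \<gamma>" using range[of "Suc x"] x len by simp
    ultimately show "x \<in> comp_set \<gamma>"
      using range[of x] x by (auto simp: comp_set_def)
  qed
qed

text \<open>The number, starting from 1, of the block containing \<open>i\<close> when positions are
  cut after each element of \<open>G\<close>; a cut at \<open>i\<close> itself comes after
  \<open>i\<close>, hence \<open>{..<i}\<close>.\<close>

definition block :: "nat set \<Rightarrow> nat \<Rightarrow> nat" where
  "block G i = Suc (card (G \<inter> {..<i}))"

lemma block_Suc: "block G (Suc i) = (if i \<in> G then Suc (block G i) else block G i)"
  by (simp add: block_def lessThan_Suc Int_insert_right)

lemma block_mono: "i \<le> j \<Longrightarrow> block G i \<le> block G j"
  by (auto simp: block_def intro!: card_mono)

lemma block_one: "G \<subseteq> {1..<n} \<Longrightarrow> block G 1 = 1"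
  by (auto simp: block_def)

lemma block_image:
  assumes "G \<subseteq> {1..<n}"
  shows "\<exists>L. block G ` {1..n} = {1..L}"
proof -
  have "block G ` {1..n} = {1..card (block G ` {1..n})}"
  proof (rule initial_segment)
    fix x assume x: "1 \<le> x" "Suc x \<in> block G ` {1..n}"
    then obtain i where i: "1 \<le> i" "i \<le> n" "block G i = Suc x" by auto
    from this(1,2,3) show "x \<in> block G ` {1..n}"
    proof (induction rule: dec_induct)
      case base
      then show ?case using block_one[OF assms] x by simp
    next
      case (step i)
      then show ?case by (cases "i \<in> G") (auto simp: block_Suc)
    qed
  qed (auto simp: block_def)
  then show ?thesis by blast
qed

text \<open>A monotone word that skips no value starts at 1 and rises by at most 1 at each step, so
  it is determined by where it rises.\<close>

lemma word_eq_block: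
  fixes w :: "nat \<Rightarrow> nat"
  assumes mono: "\<And>i j. 1 \<le> i \<Longrightarrow> i \<le> j \<Longrightarrow> j \<le> n \<Longrightarrow> w i \<le> w j"
    and im: "w ` {1..n} = {1..L}" and i: "1 \<le> i" "i \<le> n"
  shows "w i = block {i \<in> {1..<n}. w i < w (Suc i)} i"
  using i
proof (induction rule: dec_induct)
  case base
  have "w 1 \<in> w ` {1..n}" using i by auto
  then have w1: "1 \<le> w 1" "1 \<le> L" unfolding im by auto
  then have "1 \<in> w ` {1..n}" unfolding im by simp
  then obtain j where "1 \<le> j" "j \<le> n" "w j = 1" by auto
  then have "w 1 = 1" using mono[of 1 j] w1 by simp
  then show ?case by (auto simp: block_def)
next
  case (step k)
  have le: "w k \<le> w (Suc k)" by (rule mono) (use step in auto)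
  have "w (Suc k) \<le> Suc (w k)"
  proof (rule ccontr)
    assume "\<not> w (Suc k) \<le> Suc (w k)"
    moreover have "w (Suc k) \<in> w ` {1..n}" using step by auto
    then have "w (Suc k) \<le> L" unfolding im by simp
    ultimately have "Suc (w k) \<in> w ` {1..n}" unfolding im by simp
    then obtain j where j: "1 \<le> j" "j \<le> n" "w j = Suc (w k)" by auto
    then show False
      using mono[of j k] mono[of "Suc k" j] step \<open>\<not> w (Suc k) \<le> Suc (w k)\<close> by (cases "j \<le> k") auto
  qed
  then show ?case using step le by (auto simp: block_Suc)
qed

lemma weight_comp_eq_map:
  fixes T :: "nat \<times> nat \<Rightarrow> nat"
  assumes bij: "bij_betw T (diagram \<alpha>) {1..n}" and n: "0 < n"
    and w: "\<And>b. b \<in> diagram \<alpha> \<Longrightarrow> w (T b) = letter_val (f b)"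
    and im: "w ` {1..n} = {1..L}"
  shows "weight_comp \<alpha> f = map (\<lambda>v. card {i \<in> {1..n}. w i = v}) [1..<Suc L]"
proof -
  have inj: "inj_on T (diagram \<alpha>)" and T: "T ` diagram \<alpha> = {1..n}"
    using bij by (auto simp: bij_betw_def)
  have V: "(letter_val \<circ> f) ` diagram \<alpha> = {1..L}"
    unfolding im[symmetric] T[symmetric] using w by (auto simp: image_image)
  have "L \<ge> 1"
  proof -
    have "w n \<in> w ` {1..n}" using n by simp
    then show ?thesis unfolding im by auto
  qed
  then have "Max {i. weight \<alpha> f i \<noteq> 0} = L"
    unfolding weight_nonzero_iff V by (intro Max_eqI) auto
  moreover have "weight \<alpha> f v = card {i \<in> {1..n}. w i = v}" for v
  proof -
    have "T ` {b \<in> diagram \<alpha>. letter_val (f b) = v} = {i \<in> {1..n}. w i = v}"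
      unfolding T[symmetric] using w by (auto simp: image_iff)
    then show ?thesis
      unfolding weight_eq using inj card_image[of T "{b \<in> diagram \<alpha>. letter_val (f b) = v}"]
      by (metis (no_types, lifting) inj_on_subset mem_Collect_eq subsetI)
  qed
  ultimately show ?thesis by (simp add: weight_comp_def)
qed

text \<open>Marks are recorded by entries of \<open>T\<close> instead of boxes, so that
  compatibility becomes a condition on consecutive numbers. The set \<open>G\<close> will be
  \<open>comp_set \<gamma>\<close>.\<close>

definition mark_filling :: "nat list \<Rightarrow> (nat \<times> nat \<Rightarrow> nat) \<Rightarrow> nat set \<Rightarrow> nat set \<Rightarrow> nat \<times> nat \<Rightarrow> letter" where
  "mark_filling \<alpha> T G S =
    restrict (\<lambda>b. (if T b \<in> S then Marked else Unmarked) (block G (T b))) (diagram \<alpha>)"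

lemma letter_val_mark_filling: "b \<in> diagram \<alpha> \<Longrightarrow> letter_val (mark_filling \<alpha> T G S b) = block G (T b)"
  and is_Marked_mark_filling: "b \<in> diagram \<alpha> \<Longrightarrow> is_Marked (mark_filling \<alpha> T G S b) \<longleftrightarrow> T b \<in> S"
  by (auto simp: mark_filling_def)

lemma Des_left_iff:
  assumes bij: "bij_betw T (diagram \<alpha>) {1..sum_list \<alpha>}"
    and b: "b \<in> diagram \<alpha>" "b' \<in> diagram \<alpha>" "T b' = Suc (T b)"
  shows "T b \<in> Des_left \<alpha> T \<longleftrightarrow> fst b' \<le> fst b"
proof -
  have inj: "inj_on T (diagram \<alpha>)" using bij by (simp add: bij_betw_def)
  have "T b \<in> {1..sum_list \<alpha>}" "T b' \<in> {1..sum_list \<alpha>}"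
    using bij_betwE[OF bij] b by blast+
  then have range: "1 \<le> T b" "T b < sum_list \<alpha>" using b(3) by auto
  have "T b \<in> Des_left \<alpha> T \<longleftrightarrow> (\<exists>x\<in>diagram \<alpha>. \<exists>x'\<in>diagram \<alpha>. T x = T b \<and> T x' = T b' \<and> fst x' \<le> fst x)"
    using range b(3) by (fastforce simp: Des_left_def)
  also have "\<dots> \<longleftrightarrow> fst b' \<le> fst b"
    using inj b(1,2) by (metis inj_onD)
  finally show ?thesis .
qed

text \<open>The value pattern of a compatible filling is determined by its weight, so such a filling
  amounts to a choice of marks.\<close>

lemma compatible_weight_filling:
  assumes T: "standard_peak_tableau \<alpha> T" and n: "sum_list \<alpha> = n" "0 < n"
    and f: "f \<in> MPCT \<alpha>" "compatible \<alpha> T f" and \<gamma>: "weight_comp \<alpha> f = \<gamma>"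
  shows "f = mark_filling \<alpha> T (comp_set \<gamma>) {T b | b. b \<in> diagram \<alpha> \<and> is_Marked (f b)}"
proof -
  have bij: "bij_betw T (diagram \<alpha>) {1..n}" using standard_peak_tableauD(1)[OF T] n by simp
  define w where "w i = letter_val (f (inv_into (diagram \<alpha>) T i))" for i
  have w: "w (T b) = letter_val (f b)" if "b \<in> diagram \<alpha>" for b
    using that bij by (simp add: w_def bij_betw_def)
  have surj: "\<exists>b\<in>diagram \<alpha>. T b = i" if "1 \<le> i" "i \<le> n" for i
  proof -
    have "i \<in> T ` diagram \<alpha>" using bij that by (simp add: bij_betw_def)
    then show ?thesis by blast
  qed
  have mono: "w i \<le> w j" if ij: "1 \<le> i" "i \<le> j" "j \<le> n" for i j
  proof (cases "i = j")
    case False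
    obtain b b' where b: "b \<in> diagram \<alpha>" "T b = i" "b' \<in> diagram \<alpha>" "T b' = j"
      using surj[of i] surj[of j] ij by auto
    then have "f b \<le> f b'" using compatible_less[OF f(2) bij b(1) b(3)] False ij by auto
    then show ?thesis using w[OF b(1)] w[OF b(3)] b letter_val_mono by simp
  qed simp
  obtain L where "(letter_val \<circ> f) ` diagram \<alpha> = {1..L}"
    using f(1) by (auto simp: MPCT_iff)
  moreover have "w ` {1..n} = (letter_val \<circ> f) ` diagram \<alpha>"
  proof -
    have "w ` {1..n} = w ` T ` diagram \<alpha>" using bij by (simp add: bij_betw_def)
    also have "\<dots> = (letter_val \<circ> f) ` diagram \<alpha>" using w by (auto simp: image_image)
    finally show ?thesis .
  qed
  ultimately have im: "w ` {1..n} = {1..L}" by simp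
  have G: "comp_set \<gamma> = {i \<in> {1..<n}. w i < w (Suc i)}"
    using word_weights(2)[OF n(2) mono im] weight_comp_eq_map[OF bij n(2) w im] \<gamma> by simp
  show ?thesis
  proof (rule extensionalityI)
    show "f \<in> extensional (diagram \<alpha>)" using f(1) by (simp add: MPCT_iff marked_peak_tableau_def)
    show "mark_filling \<alpha> T (comp_set \<gamma>) {T b | b. b \<in> diagram \<alpha> \<and> is_Marked (f b)} \<in> extensional (diagram \<alpha>)"
      by (simp add: mark_filling_def)
    fix b assume b: "b \<in> diagram \<alpha>"
    then have "T b \<in> {1..n}" using bij_betwE[OF bij] by blast
    then have "1 \<le> T b" "T b \<le> n" by auto
    then have "letter_val (f b) = block (comp_set \<gamma>) (T b)"
      using word_eq_block[OF mono im, of "T b"] w[OF b] unfolding G by simp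
    moreover have "T b \<in> {T b | b. b \<in> diagram \<alpha> \<and> is_Marked (f b)} \<longleftrightarrow> is_Marked (f b)"
      using b bij_betw_imp_inj_on[OF bij] by (blast dest: inj_onD)
    ultimately show "f b = mark_filling \<alpha> T (comp_set \<gamma>) {T b | b. b \<in> diagram \<alpha> \<and> is_Marked (f b)} b"
      using b by (cases "f b") (auto simp: mark_filling_def)
  qed
qed

text \<open>At a cut the value rises and nothing is required. Inside a block, a descent admits the
  patterns marked-marked and marked-unmarked, so only the first letter is fixed; an ascent admits
  marked-unmarked and unmarked-unmarked, so only the second is. The weight is
  \<open>\<gamma>\<close> in any case, and compatibility already implies membership in
  \<open>MPCT\<close>.\<close>

lemma mark_filling_MPCT_iff:
  assumes \<alpha>: "peak_composition n \<alpha>" "0 < n" and T: "standard_peak_tableau \<alpha> T"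
    and \<gamma>: "composition n \<gamma>" and S: "S \<subseteq> {1..n}"
  defines "f \<equiv> mark_filling \<alpha> T (comp_set \<gamma>) S"
  shows "f \<in> MPCT \<alpha> \<and> compatible \<alpha> T f \<and> weight_comp \<alpha> f = \<gamma> \<longleftrightarrow>
    (\<forall>i\<in>{1..<n} - comp_set \<gamma>. if i \<in> Des_left \<alpha> T then i \<in> S else Suc i \<notin> S)" (is "?L \<longleftrightarrow> ?R")
proof -
  let ?G = "comp_set \<gamma>"
  have sum: "sum_list \<alpha> = n" using \<alpha> by (simp add: peak_composition_def composition_def)
  have bij0: "bij_betw T (diagram \<alpha>) {1..sum_list \<alpha>}" using standard_peak_tableauD(1)[OF T] .
  then have bij: "bij_betw T (diagram \<alpha>) {1..n}" using sum by simp
  have f: "f b = (if T b \<in> S then Marked else Unmarked) (block ?G (T b))" if "b \<in> diagram \<alpha>" for b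
    using that by (simp add: f_def mark_filling_def)
  have val: "letter_val (f b) = block ?G (T b)" if "b \<in> diagram \<alpha>" for b
    using that by (simp add: f)
  have ext: "f \<in> extensional (diagram \<alpha>)" by (simp add: f_def mark_filling_def)
  have G: "?G \<subseteq> {1..<n}" using comp_set_subset[OF \<gamma>] .
  obtain L where L: "block ?G ` {1..n} = {1..L}" using block_image[OF G] by blast
  have mono: "\<And>i j. 1 \<le> i \<Longrightarrow> i \<le> j \<Longrightarrow> j \<le> n \<Longrightarrow> block ?G i \<le> block ?G j"
    by (rule block_mono)
  have "weight_comp \<alpha> f = map (\<lambda>v. card {i \<in> {1..n}. block ?G i = v}) [1..<Suc L]"
    by (rule weight_comp_eq_map[OF bij \<alpha>(2) _ L]) (simp add: val)
  then have "composition n (weight_comp \<alpha> f)"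
    "comp_set (weight_comp \<alpha> f) = {i \<in> {1..<n}. block ?G i < block ?G (Suc i)}"
    using word_weights[OF \<alpha>(2) mono L] by simp_all
  moreover have "{i \<in> {1..<n}. block ?G i < block ?G (Suc i)} = ?G"
    using G by (auto simp: block_Suc)
  ultimately have weight: "weight_comp \<alpha> f = \<gamma>"
    using inj_on_comp_set[of n] \<gamma> by (auto dest: inj_onD)
  have "compatible \<alpha> T f \<longleftrightarrow> (\<forall>b\<in>diagram \<alpha>. \<forall>b'\<in>diagram \<alpha>. T b' = Suc (T b) \<longrightarrow> T b \<notin> ?G \<longrightarrow>
      (if T b \<in> Des_left \<alpha> T then T b \<in> S else Suc (T b) \<notin> S))"
    unfolding compatible_def
  proof (intro ball_cong refl imp_cong)
    fix b b' assume b: "b \<in> diagram \<alpha>" "b' \<in> diagram \<alpha>" "T b' = Suc (T b)"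
    show "(f b \<le> f b' \<and> (f b = f b' \<longrightarrow> (if is_Marked (f b) then fst b' \<le> fst b else fst b < fst b'))) =
      (T b \<notin> ?G \<longrightarrow> (if T b \<in> Des_left \<alpha> T then T b \<in> S else Suc (T b) \<notin> S))"
      using f[OF b(1)] f[OF b(2)] Des_left_iff[OF bij0 b]
      by (auto simp: b(3) block_Suc less_eq_letter_def)
  qed
  also have "\<dots> \<longleftrightarrow> ?R"
  proof (intro iffI ballI impI)
    fix i assume *: "\<forall>b\<in>diagram \<alpha>. \<forall>b'\<in>diagram \<alpha>. T b' = Suc (T b) \<longrightarrow> T b \<notin> ?G \<longrightarrow>
      (if T b \<in> Des_left \<alpha> T then T b \<in> S else Suc (T b) \<notin> S)" and i: "i \<in> {1..<n} - ?G"
    then have "i \<in> T ` diagram \<alpha>" "Suc i \<in> T ` diagram \<alpha>" using bij by (auto simp: bij_betw_def)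
    then show "if i \<in> Des_left \<alpha> T then i \<in> S else Suc i \<notin> S" using * i by fastforce
  next
    fix b b' assume *: ?R and b: "b \<in> diagram \<alpha>" "b' \<in> diagram \<alpha>" "T b' = Suc (T b)" "T b \<notin> ?G"
    then have "T b \<in> {1..n}" "T b' \<in> {1..n}" using bij_betwE[OF bij] by blast+
    then have "T b \<in> {1..<n} - ?G" using b by auto
    with * show "if T b \<in> Des_left \<alpha> T then T b \<in> S else Suc (T b) \<notin> S" by blast
  qed
  finally have compat: "compatible \<alpha> T f \<longleftrightarrow> ?R" .
  moreover have "f \<in> MPCT \<alpha>" if "compatible \<alpha> T f"
  proof -
    have "marked_peak_tableau \<alpha> f"
      by (rule compatible_imp_marked_peak_tableau[OF \<alpha>(1) T that ext]) (simp add: val block_def)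
    moreover have "(letter_val \<circ> f) ` diagram \<alpha> = block ?G ` T ` diagram \<alpha>"
      using val by (auto simp: image_image)
    then have "(letter_val \<circ> f) ` diagram \<alpha> = {1..L}"
      using bij L by (simp add: bij_betw_def)
    ultimately show ?thesis by (auto simp: MPCT_iff)
  qed
  ultimately show ?thesis using weight by blast
qed

text \<open>Fillings correspond to mark sets, which \<open>card_mark_sets\<close> counts. The result
  is the coefficient of \<open>M_fun \<gamma>\<close> in \<open>K_fun_set_comp\<close> for the peak
  set of \<open>T\<close>.\<close>

lemma card_compatible:
  assumes \<alpha>: "peak_composition n \<alpha>" "0 < n" and T: "standard_peak_tableau \<alpha> T"
    and \<gamma>: "composition n \<gamma>"
  shows "card {f \<in> MPCT \<alpha>. compatible \<alpha> T f \<and> weight_comp \<alpha> f = \<gamma>} =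
    (if Peak (Des_left \<alpha> T) \<subseteq> comp_set \<gamma> \<union> Suc ` comp_set \<gamma> then 2 ^ length \<gamma> else 0)"
proof -
  let ?G = "comp_set \<gamma>" and ?D = "Des_left \<alpha> T"
  let ?S = "{S. S \<subseteq> {1..n} \<and> (\<forall>i\<in>{1..<n} - ?G. if i \<in> ?D then i \<in> S else Suc i \<notin> S)}"
  have sum: "sum_list \<alpha> = n" using \<alpha> by (simp add: peak_composition_def composition_def)
  have bij: "bij_betw T (diagram \<alpha>) {1..n}" using standard_peak_tableauD(1)[OF T] sum by simp
  have "{f \<in> MPCT \<alpha>. compatible \<alpha> T f \<and> weight_comp \<alpha> f = \<gamma>} = mark_filling \<alpha> T ?G ` ?S"
  proof (intro subset_antisym subsetI)
    fix f assume f: "f \<in> {f \<in> MPCT \<alpha>. compatible \<alpha> T f \<and> weight_comp \<alpha> f = \<gamma>}"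
    let ?M = "{T b | b. b \<in> diagram \<alpha> \<and> is_Marked (f b)}"
    have eq: "f = mark_filling \<alpha> T ?G ?M"
      using compatible_weight_filling[OF T sum \<alpha>(2)] f by blast
    have M: "?M \<subseteq> {1..n}" using bij_betwE[OF bij] by blast
    have "?M \<in> ?S"
      using mark_filling_MPCT_iff[OF \<alpha> T \<gamma> M] f M unfolding eq[symmetric] by blast
    with eq show "f \<in> mark_filling \<alpha> T ?G ` ?S" by (rule image_eqI)
  qed (use mark_filling_MPCT_iff[OF \<alpha> T \<gamma>] in blast)
  moreover have "inj_on (mark_filling \<alpha> T ?G) ?S"
  proof (rule inj_onI)
    fix S S' assume S: "S \<in> ?S" "S' \<in> ?S" and eq: "mark_filling \<alpha> T ?G S = mark_filling \<alpha> T ?G S'"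
    have "i \<in> S \<longleftrightarrow> i \<in> S'" if "i \<in> {1..n}" for i
    proof -
      have "i \<in> T ` diagram \<alpha>" using bij that by (simp add: bij_betw_def)
      then obtain b where b: "b \<in> diagram \<alpha>" "T b = i" by blast
      have "is_Marked (mark_filling \<alpha> T ?G S b) \<longleftrightarrow> is_Marked (mark_filling \<alpha> T ?G S' b)"
        using eq by simp
      then show ?thesis unfolding is_Marked_mark_filling[OF b(1)] b(2) .
    qed
    then show "S = S'" using S by blast
  qed
  ultimately have "card {f \<in> MPCT \<alpha>. compatible \<alpha> T f \<and> weight_comp \<alpha> f = \<gamma>} = card ?S"
    by (simp only: card_image)
  also have "\<dots> = (if Peak ?D \<subseteq> ?G \<union> Suc ` ?G then 2 ^ Suc (card ?G) else 0)"
    by (rule card_mark_sets[OF \<alpha>(2) comp_set_subset[OF \<gamma>]]) (auto simp: Des_left_def sum)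
  also have "Suc (card ?G) = length \<gamma>"
    by (rule card_comp_set[OF \<gamma>]) (use \<gamma> \<alpha>(2) in auto)
  finally show ?thesis .
qed

section \<open>Comparison of coefficients\<close>

lemma weight_comp_composition:
  assumes f: "f \<in> MPCT \<alpha>" and n: "sum_list \<alpha> = n" "0 < n"
  shows "composition n (weight_comp \<alpha> f)"
proof -
  obtain L where L: "(letter_val \<circ> f) ` diagram \<alpha> = {1..L}"
    using f by (auto simp: MPCT_iff)
  have "diagram \<alpha> \<noteq> {}" using n card_diagram[of \<alpha>] by (metis card.empty less_irrefl)
  then have "1 \<le> L" using L by auto
  then have "Max {i. weight \<alpha> f i \<noteq> 0} = L"
    unfolding weight_nonzero_iff L by (intro Max_eqI) auto
  then have wc: "weight_comp \<alpha> f = map (weight \<alpha> f) [1..<Suc L]"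
    by (simp add: weight_comp_def)
  have "0 < weight \<alpha> f v" if "v \<in> {1..L}" for v
    using that weight_nonzero_iff[of \<alpha> f v] unfolding L by simp
  moreover have "sum_list (weight_comp \<alpha> f) = n"
  proof -
    have "sum_list (weight_comp \<alpha> f) = (\<Sum>v\<in>{1..L}. card {b \<in> diagram \<alpha>. letter_val (f b) = v})"
      by (simp add: wc weight_eq interv_sum_list_conv_sum_set_nat atLeastLessThanSuc_atLeastAtMost del: upt_Suc)
    also have "\<dots> = card (\<Union>v\<in>{1..L}. {b \<in> diagram \<alpha>. letter_val (f b) = v})"
      by (rule card_UN_disjoint[symmetric]) (auto simp: finite_diagram)
    also have "(\<Union>v\<in>{1..L}. {b \<in> diagram \<alpha>. letter_val (f b) = v}) = diagram \<alpha>"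
      unfolding L[symmetric] by auto
    finally show ?thesis using n card_diagram by simp
  qed
  ultimately show ?thesis by (auto simp: composition_def wc simp del: upt_Suc)
qed

lemma quasisym_schur_Q_M:
  assumes n: "sum_list \<alpha> = n" "0 < n"
  shows "quasisym_schur_Q \<alpha> m = (\<Sum>\<gamma> | composition n \<gamma>.
    int (card {f \<in> MPCT \<alpha>. weight_comp \<alpha> f = \<gamma>}) * M_fun \<gamma> m)"
proof -
  have "quasisym_schur_Q \<alpha> m = (\<Sum>\<gamma> | composition n \<gamma>.
      \<Sum>f\<in>{f \<in> MPCT \<alpha>. weight_comp \<alpha> f = \<gamma>}. M_fun (weight_comp \<alpha> f) m)"
    unfolding quasisym_schur_Q_def
    by (rule sum.group[symmetric])
      (use weight_comp_composition[OF _ n] in \<open>auto simp: finite_MPCT finite_compositions\<close>)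
  then show ?thesis by simp
qed

text \<open>The coefficients are stated as cardinalities of sets of marked tableaux rather than
  powers of 2, so that they can be compared with those of \<open>quasisym_schur_Q_M\<close> as
  sets.\<close>

lemma peak_young_schur_M:
  assumes \<alpha>: "peak_composition n \<alpha>" "0 < n"
  shows "peak_young_schur \<alpha> m = (\<Sum>\<gamma> | composition n \<gamma>.
    int (\<Sum>T\<in>SPYCT \<alpha>. card {f \<in> MPCT \<alpha>. compatible \<alpha> T f \<and> weight_comp \<alpha> f = \<gamma>}) * M_fun \<gamma> m)"
proof -
  have n: "sum_list \<alpha> = n" using \<alpha> by (simp add: peak_composition_def composition_def)
  have "K_fun (set_comp n (Peak (Des_left \<alpha> T))) m = (\<Sum>\<gamma> | composition n \<gamma>.
      int (card {f \<in> MPCT \<alpha>. compatible \<alpha> T f \<and> weight_comp \<alpha> f = \<gamma>}) * M_fun \<gamma> m)"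
    if T: "T \<in> SPYCT \<alpha>" for T
  proof -
    have std: "standard_peak_tableau \<alpha> T" using T by (simp add: SPYCT_iff)
    have D: "Des_left \<alpha> T \<subseteq> {1..<n}" by (auto simp: Des_left_def n)
    have "K_fun (set_comp n (Peak (Des_left \<alpha> T))) m = (\<Sum>\<gamma> | composition n \<gamma>.
      (if Peak (Des_left \<alpha> T) \<subseteq> comp_set \<gamma> \<union> Suc ` comp_set \<gamma> then 2 ^ length \<gamma> else 0) * M_fun \<gamma> m)"
    proof (rule K_fun_set_comp[OF \<alpha>(2)])
      show "Peak (Des_left \<alpha> T) \<subseteq> {1..<n}" using D by (auto simp: Peak_def)
      show "2 \<le> p \<and> p - 1 \<notin> Peak (Des_left \<alpha> T)" if "p \<in> Peak (Des_left \<alpha> T)" for p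
        using that D by (fastforce simp: Peak_def)
    qed
    also have "\<dots> = (\<Sum>\<gamma> | composition n \<gamma>.
      int (card {f \<in> MPCT \<alpha>. compatible \<alpha> T f \<and> weight_comp \<alpha> f = \<gamma>}) * M_fun \<gamma> m)"
      by (rule sum.cong) (simp_all add: card_compatible[OF \<alpha> std])
    finally show ?thesis .
  qed
  then have "peak_young_schur \<alpha> m = (\<Sum>T\<in>SPYCT \<alpha>. \<Sum>\<gamma> | composition n \<gamma>.
      int (card {f \<in> MPCT \<alpha>. compatible \<alpha> T f \<and> weight_comp \<alpha> f = \<gamma>}) * M_fun \<gamma> m)"
    by (simp add: peak_young_schur_def n)
  also have "\<dots> = (\<Sum>\<gamma> | composition n \<gamma>. \<Sum>T\<in>SPYCT \<alpha>.
      int (card {f \<in> MPCT \<alpha>. compatible \<alpha> T f \<and> weight_comp \<alpha> f = \<gamma>}) * M_fun \<gamma> m)"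
    by (rule sum.swap)
  finally show ?thesis by (simp add: sum_distrib_right)
qed

text \<open>Unique standardization splits the marked tableaux of each weight into the disjoint sets
  of fillings compatible with the members of SPYCT.\<close>

lemma narrow_imp_eq:
  assumes \<alpha>: "peak_composition n \<alpha>" "0 < n" and nar: "narrow \<alpha>"
  shows "quasisym_schur_Q \<alpha> = peak_young_schur \<alpha>"
proof -
  have n: "sum_list \<alpha> = n" using \<alpha> by (simp add: peak_composition_def composition_def)
  note std = MPCT_standardization[OF \<alpha>(1) nar]
  have "card {f \<in> MPCT \<alpha>. weight_comp \<alpha> f = \<gamma>} =
    (\<Sum>T\<in>SPYCT \<alpha>. card {f \<in> MPCT \<alpha>. compatible \<alpha> T f \<and> weight_comp \<alpha> f = \<gamma>})" for \<gamma>
  proof -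
    have "{f \<in> MPCT \<alpha>. weight_comp \<alpha> f = \<gamma>} =
      (\<Union>T\<in>SPYCT \<alpha>. {f \<in> MPCT \<alpha>. compatible \<alpha> T f \<and> weight_comp \<alpha> f = \<gamma>})"
      using std by blast
    also have "card \<dots> = (\<Sum>T\<in>SPYCT \<alpha>. card {f \<in> MPCT \<alpha>. compatible \<alpha> T f \<and> weight_comp \<alpha> f = \<gamma>})"
      by (rule card_UN_disjoint) (use std in \<open>auto simp: finite_SPYCT finite_MPCT\<close>)
    finally show ?thesis .
  qed
  then show ?thesis
    unfolding fun_eq_iff quasisym_schur_Q_M[OF n \<alpha>(2)] peak_young_schur_M[OF \<alpha>] by simp
qed

text \<open>Filling the first two columns row by row, and only then the remaining boxes, violates the
  triple condition (4) as soon as some row of length at least 3 lies below one of length at least 2.\<close>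

lemma extra_standard_tableau:
  assumes \<alpha>: "peak_composition n \<alpha>" and nar: "\<not> narrow \<alpha>"
  shows "\<exists>T. standard_peak_tableau \<alpha> T \<and> T \<notin> SPYCT \<alpha>"
proof -
  \<comment> \<open>Lexicographic with \<open>False < True\<close>, so the boolean component
    postpones every box beyond column 2.\<close>
  define key :: "nat \<times> nat \<Rightarrow> bool \<times> nat \<times> nat" where "key = (\<lambda>(c, r). (3 \<le> c, r, c))"
  have inj: "inj_on key (diagram \<alpha>)" by (auto simp: key_def inj_on_def)
  define T where "T = rank_filling (diagram \<alpha>) key"
  note less_iff = rank_filling_less_iff[OF finite_diagram inj, folded T_def]
  have std: "standard_peak_tableau \<alpha> T"
  proof (rule standard_peak_tableauI[OF \<alpha>])
    show "T \<in> extensional (diagram \<alpha>)" by (simp add: T_def rank_filling_def)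
    show "bij_betw T (diagram \<alpha>) {1..sum_list \<alpha>}"
      using bij_betw_rank_filling[OF finite_diagram inj] by (simp add: T_def card_diagram)
    show "T (c, r) < T (c', r)" if "(c, r) \<in> diagram \<alpha>" "(c', r) \<in> diagram \<alpha>" "c < c'" for c c' r
      using that less_iff by (auto simp: key_def less_prod_def')
    show "T (2, r) < T (1, Suc r)" if "1 \<le> r" "(1, Suc r) \<in> diagram \<alpha>" for r
      using that less_iff peak_diagram_second[OF \<alpha> that] by (auto simp: key_def less_prod_def')
  qed
  obtain r r' where r: "r' < r" "(3, r') \<in> diagram \<alpha>" "(2, r) \<in> diagram \<alpha>"
    using nar by (auto simp: narrow_def)
  \<comment> \<open>Condition (4) fails with \<open>c = 2\<close>: the box \<open>(3, r)\<close> is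
    either absent or filled after \<open>(3, r')\<close>, since the key takes lower rows
    first.\<close>
  have "T (2, r) < T (3, r')" using less_iff[OF r(3,2)] by (simp add: key_def less_prod_def')
  moreover have "\<not> T (3, r) < T (3, r')" if "(3, r) \<in> diagram \<alpha>"
    using less_iff[OF that r(2)] r(1) by (simp add: key_def less_prod_def')
  ultimately have "T \<notin> SPYCT \<alpha>"
    using r unfolding SPYCT_iff by (metis numeral_2_eq_2 numeral_3_eq_3 Suc_eq_plus1)
  with std show ?thesis by blast
qed

section \<open>The squarefree coefficient\<close>

lemma comp_set_replicate_one: "comp_set (replicate n 1) = {1..<n}"
  by (auto simp: comp_set_def sum_list_replicate min_def)

text \<open>With a cut after every position, each block is a single entry, so the values of the
  filling are the entries of \<open>T\<close>. Hence different tableaux share no compatible filling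
  of this weight.\<close>

lemma standard_tableau_weight_one:
  assumes T: "standard_peak_tableau \<alpha> T" and n: "sum_list \<alpha> = n" "0 < n"
    and f: "f \<in> MPCT \<alpha>" "compatible \<alpha> T f" "weight_comp \<alpha> f = replicate n 1"
  shows "T = restrict (letter_val \<circ> f) (diagram \<alpha>)"
proof (rule extensionalityI)
  show "T \<in> extensional (diagram \<alpha>)" using T by (simp add: standard_peak_tableau_def)
  show "restrict (letter_val \<circ> f) (diagram \<alpha>) \<in> extensional (diagram \<alpha>)" by simp
  fix b assume b: "b \<in> diagram \<alpha>"
  then have "T b \<in> {1..n}"
    using bij_betwE[OF standard_peak_tableauD(1)[OF T]] n by blast
  then have "{1..<n} \<inter> {..<T b} = {1..<T b}" "1 \<le> T b" by auto
  then have "block {1..<n} (T b) = T b" by (simp add: block_def)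
  moreover have "letter_val (f b) = block (comp_set (replicate n 1)) (T b)"
    by (subst compatible_weight_filling[OF T n f]) (simp add: letter_val_mark_filling b)
  ultimately show "T b = restrict (letter_val \<circ> f) (diagram \<alpha>) b"
    unfolding comp_set_replicate_one using b by simp
qed

text \<open>Each part of \<open>\<gamma>\<close> is bounded by an exponent of any monomial occurring
  in \<open>M_fun \<gamma>\<close>, and the exponents here are at most 1.\<close>

lemma M_fun_squarefree:
  assumes \<gamma>: "composition n \<gamma>"
  shows "M_fun \<gamma> (monomial [1..<Suc n] (replicate n 1)) \<noteq> 0 \<longleftrightarrow> \<gamma> = replicate n 1"
proof -
  let ?m = "monomial [1..<Suc n] (replicate n 1)"
  let ?I = "{is. length is = length \<gamma> \<and> sorted_wrt (<) is \<and> (\<forall>i\<in>set is. 1 \<le> i) \<and> monomial is \<gamma> = ?m}"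
  have pos: "\<forall>a\<in>set \<gamma>. 0 < a" using \<gamma> by (simp add: composition_def)
  have "M_fun \<gamma> ?m \<noteq> 0 \<longleftrightarrow> ?I \<noteq> {}"
    using finite_monomial_indices[OF pos, of ?m] by (simp add: M_fun_def)
  also have "\<dots> \<longleftrightarrow> \<gamma> = replicate n 1"
  proof
    assume "?I \<noteq> {}"
    then obtain "is" where len: "length is = length \<gamma>" and sorted: "sorted_wrt (<) is"
      and m: "monomial is \<gamma> = ?m" by auto
    have m1: "Poly_Mapping.lookup ?m i \<le> 1" for i
    proof -
      \<comment> \<open>The list entry at \<open>j\<close> is \<open>Suc j\<close>; the index 0 is
        excluded separately because \<open>i - 1\<close> truncates to 0 there.\<close>
      have "Poly_Mapping.lookup ?m i = (\<Sum>j<n. if j = i - 1 \<and> i \<noteq> 0 then 1 else 0)"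
        unfolding monomial_def lookup_sum
        by (rule sum.cong) (auto simp: lookup_single when_def simp del: upt_Suc)
      then show ?thesis by (cases i) auto
    qed
    have "\<gamma> ! j = 1" if j: "j < length \<gamma>" for j
    proof -
      have "\<gamma> ! j = Poly_Mapping.lookup (Poly_Mapping.single (is ! j) (\<gamma> ! j)) (is ! j)" by simp
      also have "\<dots> \<le> (\<Sum>k<length \<gamma>. Poly_Mapping.lookup (Poly_Mapping.single (is ! k) (\<gamma> ! k)) (is ! j))"
        by (rule member_le_sum) (use j in auto)
      also have "\<dots> = Poly_Mapping.lookup ?m (is ! j)"
        unfolding m[symmetric] by (simp add: monomial_def lookup_sum)
      finally have "\<gamma> ! j \<le> 1" using m1[of "is ! j"] by simp
      moreover have "0 < \<gamma> ! j" using pos j by simp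
      ultimately show ?thesis by simp
    qed
    then have rep: "\<gamma> = replicate (length \<gamma>) 1" by (simp add: list_eq_iff_nth_eq)
    moreover have "sum_list \<gamma> = length \<gamma>" by (subst rep) (simp add: sum_list_replicate)
    ultimately show "\<gamma> = replicate n 1" using \<gamma> by (simp add: composition_def)
  next
    assume "\<gamma> = replicate n 1"
    then have "[1..<Suc n] \<in> ?I" by (auto simp del: upt_Suc)
    then show "?I \<noteq> {}" by blast
  qed
  finally show ?thesis .
qed

lemma sum_squarefree:
  assumes "0 < n"
  shows "(\<Sum>\<gamma> | composition n \<gamma>. c \<gamma> * M_fun \<gamma> (monomial [1..<Suc n] (replicate n 1))) =
    c (replicate n 1) * M_fun (replicate n 1) (monomial [1..<Suc n] (replicate n 1))"
proof -
  have "composition n (replicate n 1)" by (auto simp: composition_def sum_list_replicate)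
  then have "{replicate n 1} \<subseteq> {\<gamma>. composition n \<gamma>}" by blast
  then have "(\<Sum>\<gamma>\<in>{replicate n 1}. c \<gamma> * M_fun \<gamma> (monomial [1..<Suc n] (replicate n 1))) =
    (\<Sum>\<gamma> | composition n \<gamma>. c \<gamma> * M_fun \<gamma> (monomial [1..<Suc n] (replicate n 1)))"
    by (rule sum.mono_neutral_left[OF finite_compositions])
      (use M_fun_squarefree[of n] in \<open>auto simp del: upt_Suc\<close>)
  then show ?thesis by simp
qed

text \<open>Adding one tableau outside SPYCT to the sum keeps the sets of compatible fillings
  disjoint and inside the marked tableaux of this weight, so the equality of coefficients would be
  violated.\<close>

lemma not_narrow_imp_neq:
  assumes \<alpha>: "peak_composition n \<alpha>" "0 < n" and nar: "\<not> narrow \<alpha>"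
  shows "quasisym_schur_Q \<alpha> \<noteq> peak_young_schur \<alpha>"
proof
  assume eq: "quasisym_schur_Q \<alpha> = peak_young_schur \<alpha>"
  have n: "sum_list \<alpha> = n" using \<alpha> by (simp add: peak_composition_def composition_def)
  let ?e = "replicate n 1 :: nat list"
  let ?m = "monomial [1..<Suc n] ?e"
  let ?F = "\<lambda>T. {f \<in> MPCT \<alpha>. compatible \<alpha> T f \<and> weight_comp \<alpha> f = ?e}"
  have e: "composition n ?e" by (auto simp: composition_def sum_list_replicate)
  then have "M_fun ?e ?m \<noteq> 0" using M_fun_squarefree by blast
  then have q: "card {f \<in> MPCT \<alpha>. weight_comp \<alpha> f = ?e} = (\<Sum>T\<in>SPYCT \<alpha>. card (?F T))"
    using fun_cong[OF eq, of ?m] unfolding quasisym_schur_Q_M[OF n \<alpha>(2)] peak_young_schur_M[OF \<alpha>]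
      sum_squarefree[OF \<alpha>(2)] by (simp del: upt_Suc of_nat_sum)
  obtain T where T: "standard_peak_tableau \<alpha> T" "T \<notin> SPYCT \<alpha>"
    using extra_standard_tableau[OF \<alpha>(1) nar] by blast
  have std: "standard_peak_tableau \<alpha> U" if "U \<in> insert T (SPYCT \<alpha>)" for U
    using that T by (auto simp: SPYCT_iff)
  \<comment> \<open>Every position is a cut, so the peak condition is automatic and the extra
    tableau contributes a positive power of 2.\<close>
  have "Peak (Des_left \<alpha> T) \<subseteq> comp_set ?e"
    unfolding comp_set_replicate_one by (auto simp: Peak_def Des_left_def n)
  then have "0 < card (?F T)" using card_compatible[OF \<alpha> T(1) e] by auto
  then have "(\<Sum>U\<in>SPYCT \<alpha>. card (?F U)) < (\<Sum>U\<in>insert T (SPYCT \<alpha>). card (?F U))"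
    using T(2) finite_SPYCT by simp
  also have "\<dots> = card (\<Union>U\<in>insert T (SPYCT \<alpha>). ?F U)"
  proof (rule card_UN_disjoint[symmetric])
    show "\<forall>U\<in>insert T (SPYCT \<alpha>). \<forall>U'\<in>insert T (SPYCT \<alpha>). U \<noteq> U' \<longrightarrow> ?F U \<inter> ?F U' = {}"
      using standard_tableau_weight_one[OF std n \<alpha>(2)] by blast
  qed (auto simp: finite_SPYCT finite_MPCT)
  also have "\<dots> \<le> card {f \<in> MPCT \<alpha>. weight_comp \<alpha> f = ?e}"
    by (rule card_mono) (auto simp: finite_MPCT)
  finally show False using q by simp
qed

text \<open>All rows below a row of length at least 2 must have length exactly 2. The topmost such
  row is the last one or, if the last part is 1, the one before it.\<close>

lemma narrow_iff:
  assumes \<alpha>: "peak_composition n \<alpha>" "0 < n"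
  shows "narrow \<alpha> \<longleftrightarrow> (\<exists>j a. \<alpha> = replicate j 2 @ [a]) \<or> (\<exists>j a. \<alpha> = replicate j 2 @ [a, 1])"
proof
  assume nar: "narrow \<alpha>"
  have pos: "\<forall>a\<in>set \<alpha>. 0 < a" and big: "\<forall>a\<in>set (butlast \<alpha>). 1 < a"
    using \<alpha>(1) by (auto simp: peak_composition_def composition_def)
  have two: "xs = replicate (length xs) 2"
    if xs: "\<alpha> = xs @ z # zs" "2 \<le> z" "\<forall>a\<in>set xs. 1 < a" for xs z zs
  proof -
    have "xs ! i = 2" if i: "i < length xs" for i
    proof -
      have "(2, Suc (length xs)) \<in> diagram \<alpha>" using xs by (simp add: mem_diagram)
      moreover have "Suc i < Suc (length xs)" using i by simp
      ultimately have "(3, Suc i) \<notin> diagram \<alpha>" using nar unfolding narrow_def by blast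
      then have "xs ! i \<le> 2" using i xs(1) by (simp add: mem_diagram nth_append)
      moreover have "1 < xs ! i" using xs(3) i by simp
      ultimately show ?thesis by simp
    qed
    then show ?thesis by (simp add: list_eq_iff_nth_eq)
  qed
  have "\<alpha> \<noteq> []" using \<alpha> by (auto simp: peak_composition_def)
  then obtain xs z where xs: "\<alpha> = xs @ [z]" by (cases \<alpha> rule: rev_cases) auto
  show "(\<exists>j a. \<alpha> = replicate j 2 @ [a]) \<or> (\<exists>j a. \<alpha> = replicate j 2 @ [a, 1])"
  \<comment> \<open>The alternative \<open>xs = []\<close> covers the one-row shapes, in particular
    \<open>(1)\<close>, which has no row of length 2 at all.\<close>
  proof (cases "2 \<le> z \<or> xs = []")
    case True
    then have "xs = replicate (length xs) 2" using two[of xs z "[]"] xs big by auto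
    then show ?thesis using xs by metis
  next
    case False
    then obtain ys a where ys: "xs = ys @ [a]" by (cases xs rule: rev_cases) auto
    have "ys = replicate (length ys) 2" using two[of ys a "[z]"] xs ys big by (auto simp: butlast_append)
    moreover have "z = 1" using False xs pos by auto
    ultimately show ?thesis using xs ys by (metis append.assoc append_Cons append_Nil)
  qed
next
  assume "(\<exists>j a. \<alpha> = replicate j 2 @ [a]) \<or> (\<exists>j a. \<alpha> = replicate j 2 @ [a, 1])"
  then show "narrow \<alpha>"
    by (auto simp: narrow_def mem_diagram nth_append nth_Cons' split: if_splits)
qed

theorem proposition4p20:
  fixes n :: nat and \<alpha> :: "nat list"
  assumes "0 < n" and "peak_composition n \<alpha>"
  shows "quasisym_schur_Q \<alpha> = peak_young_schur \<alpha> \<longleftrightarrow>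
    (\<exists>j a. \<alpha> = replicate j 2 @ [a]) \<or> (\<exists>j a. \<alpha> = replicate j 2 @ [a, 1])"
  using narrow_imp_eq not_narrow_imp_neq narrow_iff assms by metis

end
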